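(* Let $k$ and $n$ be positive integers. For $m\in\{0,1,2\}$, we have $$(-1)^{k-1}\left(C_m(n)-\sum_{j=-k}^{k}(-1)^j\,u_m\big(n-j(3j-1)/2\big)\right)=\sum_{j=0}^{n}C_m(j)\,\widetilde{P}_k(n-j).$$
   Context: Unimodal compositions. A composition of a positive integer $n$ is a sequence $(\lambda_1,\ldots,\lambda_r)$ of positive integers (parts) with sum $n$. It is unimodal if there exists $t\in\{1,\ldots,r\}$ with $\lambda_1\leqslant\cdots\leqslant\lambda_t$ and $\lambda_t\geqslant\cdots\geqslant\lambda_r$. For $n\geqslant 1$, $u_0(n)$ is the number of unimodal compositions of $n$, and $u_0(0)=0$. For $m\geqslant1$ and $n\geqslant0$, $u_m(n)$ is the number of unimodal compositions of $n+m$ in which the maximal part appears exactly $m$ times; in particular $u_m(0)=1$. Convention: $u_m(n)=0$ for $n<0$. Crank. For a partition $\lambda=(\lambda_1\geqslant\lambda_2\geqslant\cdots)$, let $\omega(\lambda)$ be the number of parts of $\lambda$ equal to $1$, and $\mu(\lambda)$ the number of parts of $\lambda$ larger than $\omega(\lambda)$. The crank is $c(\lambda)=\lambda_1$ (the largest part) if $\omega(\lambda)=0$, and $c(\lambda)=\mu(\lambda)-\omega(\lambda)$ if $\omega(\lambda)>0$. The empty partition of $0$ has crank $0$. For a non-negative integer $n\neq1$: $C_0(n)$ is the number of partitions $\lambda$ of $n$ with $c(\lambda)>0$; $C_1(n)$ is the number of partitions $\lambda$ of $n$ with $c(\lambda)\geqslant0$; $C_2(n)$ is the number of partitions $\lambda$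 of $n$ with $c(\lambda)=0$. Thus $C_0(0)=0$ and $C_1(0)=C_2(0)=1$. Moreover, by definition, $C_0(1)=1$, $C_1(1)=0$, $C_2(1)=-1$. $\widetilde{P}_k(n)$ (for $k\geqslant 1$, $n\geqslant 0$) is the number of partitions of $n$ in which every integer $1,2,\ldots,k$ appears as a part at least once, and the first part larger than $k$ (i.e. the smallest part among the parts exceeding $k$, which is required to exist) appears at least $k+1$ times; in particular $\widetilde{P}_k(0)=0$. *)

theory Defs
  imports Complex_Main "HOL-Library.Multiset"
begin

definition composition_of :: "nat \<Rightarrow> nat list \<Rightarrow> bool" where
  "composition_of n xs \<longleftrightarrow> (\<forall>x \<in> set xs. 0 < x) \<and> sum_list xs = n"

(* The index t is 1-based: take t xs lists the parts 1..t and drop (t - 1) xs the parts t..r. *)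
definition unimodal :: "nat list \<Rightarrow> bool" where
  "unimodal xs \<longleftrightarrow>
     (\<exists>t \<in> {1..length xs}. sorted_wrt (\<le>) (take t xs) \<and> sorted_wrt (\<ge>) (drop (t - 1) xs))"

definition unimodal_count :: "nat \<Rightarrow> int \<Rightarrow> nat" where
  "unimodal_count m n =
     (if n < 0 then 0
      else if m = 0 then
        (if n = 0 then 0 else card {xs. composition_of (nat n) xs \<and> unimodal xs})
      else card {xs. composition_of (nat n + m) xs \<and> unimodal xs \<and>
                     count_list xs (Max (set xs)) = m})"

definition partition_of :: "nat \<Rightarrow> nat multiset \<Rightarrow> bool" where
  "partition_of n p \<longleftrightarrow> (\<forall>x \<in># p. 0 < x) \<and> sum_mset p = n"

definition num_ones :: "nat multiset \<Rightarrow> nat" where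
  "num_ones p = count p 1"

definition num_parts_gt_ones :: "nat multiset \<Rightarrow> nat" where
  "num_parts_gt_ones p = size {#x \<in># p. num_ones p < x#}"

definition crank :: "nat multiset \<Rightarrow> int" where
  "crank p =
     (if p = {#} then 0
      else if num_ones p = 0 then int (Max (set_mset p))
      else int (num_parts_gt_ones p) - int (num_ones p))"

definition crank_count_pos :: "nat \<Rightarrow> int" where
  "crank_count_pos n = (if n = 1 then 1 else int (card {p. partition_of n p \<and> 0 < crank p}))"

definition crank_count_nonneg :: "nat \<Rightarrow> int" where
  "crank_count_nonneg n = (if n = 1 then 0 else int (card {p. partition_of n p \<and> 0 \<le> crank p}))"

definition crank_count_zero :: "nat \<Rightarrow> int" where
  "crank_count_zero n = (if n = 1 then -1 else int (card {p. partition_of n p \<and> crank p = 0}))"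

(* Only the indices m = 0, 1, 2 are meaningful. *)
definition crank_count :: "nat \<Rightarrow> nat \<Rightarrow> int" where
  "crank_count m =
     (if m = 0 then crank_count_pos
      else if m = 1 then crank_count_nonneg
      else crank_count_zero)"

definition Ptilde :: "nat \<Rightarrow> nat \<Rightarrow> nat" where
  "Ptilde k n =
     card {p. partition_of n p \<and> (\<forall>i \<in> {1..k}. i \<in># p) \<and>
              (\<exists>x \<in># p. k < x) \<and> k + 1 \<le> count p (Min {x. x \<in># p \<and> k < x})}"

text \<open>The sets counted above are finite, so no cardinality is 0 by the infinite-set convention.\<close>

lemma composition_of_length_le:
  assumes "composition_of n xs"
  shows "length xs \<le> n"
proof -
  have "\<forall>x \<in> set xs. 0 < x \<Longrightarrow> length xs \<le> sum_list xs" for xs :: "nat list"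
    by (induction xs) (auto simp: Suc_le_eq)
  then show ?thesis
    using assms unfolding composition_of_def by blast
qed

lemma finite_compositions: "finite {xs. composition_of n xs}"
proof (rule finite_subset)
  show "{xs. composition_of n xs} \<subseteq> {xs. set xs \<subseteq> {..n} \<and> length xs \<le> n}"
    using member_le_sum_list composition_of_length_le
    by (fastforce simp: composition_of_def)
  show "finite {xs. set xs \<subseteq> {..n} \<and> length xs \<le> n}"
    by (intro finite_lists_length_le) simp
qed

lemma finite_partitions: "finite {p. partition_of n p}"
proof (rule finite_surj[OF finite_compositions])
  show "{p. partition_of n p} \<subseteq> mset ` {xs. composition_of n xs}"
  proof
    fix p assume p: "p \<in> {p. partition_of n p}"
    obtain xs where "mset xs = p"
      using ex_mset by blast
    with p have "composition_of n xs"
      by (auto simp: partition_of_def composition_of_def sum_mset_sum_list)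
    with \<open>mset xs = p\<close> show "p \<in> mset ` {xs. composition_of n xs}"
      by blast
  qed
qed

lemma partition_of_0_iff: "partition_of 0 p \<longleftrightarrow> p = {#}"
  by (cases p) (auto simp: partition_of_def)

lemma crank_count_at_0: "crank_count 0 0 = 0" "crank_count 1 0 = 1" "crank_count 2 0 = 1"
  by (simp_all add: crank_count_def crank_count_pos_def crank_count_nonneg_def
      crank_count_zero_def partition_of_0_iff crank_def conj_commute cong: conj_cong)

lemma Ptilde_at_0: "Ptilde k 0 = 0"
  by (simp add: Ptilde_def partition_of_0_iff cong: conj_cong)

lemma unimodal_count_at_0:
  assumes "0 < m"
  shows "unimodal_count m 0 = 1"
proof -
  have "{xs. composition_of m xs \<and> unimodal xs \<and> count_list xs (Max (set xs)) = m}
        = {replicate m 1}" (is "?A = _")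
  proof (intro equalityI subsetI)
    fix xs assume "xs \<in> ?A"
    then have xs: "composition_of m xs" "count_list xs (Max (set xs)) = m"
      by auto
    have len: "length xs = m"
      using composition_of_length_le[OF xs(1)] count_le_length[of xs "Max (set xs)"] xs(2)
      by simp
    have "\<forall>x \<in> set xs. 0 < x \<Longrightarrow> sum_list xs \<le> length xs \<Longrightarrow> xs = replicate (length xs) 1"
      for xs :: "nat list"
    proof (induction xs)
      case (Cons a xs)
      have "length xs \<le> sum_list xs"
        using Cons.prems(1) composition_of_length_le[of "sum_list xs" xs]
        by (simp add: composition_of_def)
      with Cons show ?case by auto
    qed simp
    then show "xs \<in> {replicate m 1}"
      using xs(1) len by (auto simp: composition_of_def)
  next
    fix xs assume "xs \<in> {replicate m (1::nat)}"
    then have xs: "xs = replicate m 1" by simp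
    have "composition_of m xs"
      by (auto simp: xs composition_of_def sum_list_replicate)
    moreover have "unimodal xs"
      unfolding unimodal_def using assms
      by (intro bexI[of _ 1]) (auto simp: xs sorted_wrt_iff_nth_less)
    moreover have "count_list xs (Max (set xs)) = m"
    proof -
      have "count_list (replicate j x) x = j" for j and x :: nat
        by (induction j) auto
      then show ?thesis using assms by (simp add: xs)
    qed
    ultimately show "xs \<in> ?A" by simp
  qed
  then show ?thesis
    using assms by (simp add: unimodal_count_def)
qed

end

theory Submission
  imports Defs "HOL-Computational_Algebra.Formal_Power_Series"
begin

text \<open>
  Write \<open>(q)\<^sub>x = (1 - q) \<cdots> (1 - q\<^sup>x)\<close> and let \<open>P = 1/(q)\<^sub>\<infinity>\<close> generate all partitions. The claim is the
  product of two power series identities. First, \<open>P C\<^sub>m = U\<^sub>m\<close>: splitting off the peak gives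
  \<open>U\<^sub>m = \<Sum>\<^sub>x q\<^bsup>mx\<^esup>/(q)\<^sub>x\<^sup>2\<close> for \<open>m > 0\<close>; splitting a partition into its ones, its parts up to the number of
  ones, and its larger parts gives \<open>C\<^sub>1\<close> and \<open>C\<^sub>2\<close> as double and single sums, which a Durfee-type
  identity for \<open>1/((q)\<^sub>N (q)\<^bsub>N+r\<^esub>)\<close> brings into the required shape; \<open>C\<^sub>0 = C\<^sub>1 - C\<^sub>2\<close> and
  \<open>U\<^sub>0 = U\<^sub>1 - U\<^sub>2\<close>. Second, the truncated pentagonal number theorem: the series of \<open>Ptilde k\<close> is
  \<open>(-1)\<^sup>k (S\<^sub>k P - 1)\<close>, where \<open>S\<^sub>k\<close> is the truncated pentagonal sum. This follows by induction on \<open>k\<close>,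
  since the series of \<open>Ptilde k\<close> and \<open>Ptilde (k + 1)\<close> add up to \<open>P\<close> times the
  \<open>(k + 1)\<close>-st pair of pentagonal terms.
\<close>

unbundle fps_syntax

section \<open>Summation of power series\<close>

text \<open>
  The shift by \<open>X\<^sup>i\<close> in \<open>xsum g = \<Sum>\<^sub>i X\<^sup>i g\<^sub>i\<close> makes every coefficient a finite sum, so that no
  convergence condition is ever needed.
\<close>

definition xsum :: "(nat \<Rightarrow> int fps) \<Rightarrow> int fps" where
  "xsum g = Abs_fps (\<lambda>n. \<Sum>i\<le>n. g i $ (n - i))"

lemma xsum_nth: "xsum g $ n = (\<Sum>i\<le>n. g i $ (n - i))"
  by (simp add: xsum_def)

text \<open>Summands with index above \<open>n\<close> have order above \<open>n\<close>, so one
  finite partial sum gives all coefficients up to \<open>N\<close>. This reduces algebra with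
  \<open>xsum\<close> to algebra with finite sums.\<close>

lemma xsum_nth_eq_partial_sum:
  assumes "n \<le> N"
  shows "xsum g $ n = (\<Sum>i\<le>N. fps_X ^ i * g i) $ n"
proof -
  have "(\<Sum>i\<le>N. fps_X ^ i * g i) $ n = (\<Sum>i\<le>N. if n < i then 0 else g i $ (n - i))"
    by (simp add: fps_sum_nth fps_X_power_mult_nth)
  also have "\<dots> = (\<Sum>i\<le>n. if n < i then 0 else g i $ (n - i))"
    using assms by (intro sum.mono_neutral_right) auto
  finally show ?thesis by (simp add: xsum_nth)
qed

lemma xsum_mult_left: "c * xsum g = xsum (\<lambda>i. c * g i)"
proof (rule fps_ext)
  fix n
  \<comment> \<open>The Cauchy product uses only coefficients up to \<open>n\<close> of
    \<open>xsum g\<close>, so the single truncation at \<open>n\<close> serves them all.\<close>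
  have "(c * xsum g) $ n = (c * (\<Sum>i\<le>n. fps_X ^ i * g i)) $ n"
    unfolding fps_mult_nth by (intro sum.cong refl) (simp add: xsum_nth_eq_partial_sum[of _ n])
  also have "\<dots> = xsum (\<lambda>i. c * g i) $ n"
    by (simp add: xsum_nth_eq_partial_sum[of n n] sum_distrib_left mult.left_commute)
  finally show "(c * xsum g) $ n = xsum (\<lambda>i. c * g i) $ n" .
qed

lemma xsum_diff: "xsum f - xsum g = xsum (\<lambda>i. f i - g i)"
  by (rule fps_ext) (simp add: xsum_nth sum_subtractf)

lemma xsum_split: "xsum g = g 0 + fps_X * xsum (\<lambda>i. g (Suc i))"
proof (rule fps_ext)
  fix n
  show "xsum g $ n = (g 0 + fps_X * xsum (\<lambda>i. g (Suc i))) $ n"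
    by (cases n) (simp_all add: xsum_nth sum.atMost_Suc_shift del: sum.atMost_Suc)
qed

text \<open>The two shifts multiply to \<open>fps_X ^ (i + j)\<close>, so collecting the terms with
  \<open>i + j = m\<close> leaves exactly one shift by \<open>m\<close>.\<close>

lemma xsum_xsum_antidiagonal:
  "xsum (\<lambda>i. xsum (\<lambda>j. g i j)) = xsum (\<lambda>m. \<Sum>i\<le>m. g i (m - i))"
proof (rule fps_ext)
  fix n
  have "xsum (\<lambda>i. xsum (\<lambda>j. g i j)) $ n = (\<Sum>i\<le>n. \<Sum>j\<le>n - i. g i j $ (n - i - j))"
    by (simp add: xsum_nth)
  also have "\<dots> = (\<Sum>(i, j)\<in>(SIGMA i:{..n}. {..n - i}). g i j $ (n - i - j))"
    by (rule sum.Sigma) auto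
  also have "(SIGMA i:{..n}. {..n - i}) = {(i, j). i + j \<le> n}"
    by auto
  also have "(\<Sum>(i, j)\<in>\<dots>. g i j $ (n - i - j))
      = (\<Sum>m\<le>n. \<Sum>i\<le>m. g i (m - i) $ (n - i - (m - i)))"
    by (rule sum.triangle_reindex_eq)
  also have "\<dots> = xsum (\<lambda>m. \<Sum>i\<le>m. g i (m - i)) $ n"
    by (simp add: xsum_nth fps_sum_nth)
  finally show "xsum (\<lambda>i. xsum (\<lambda>j. g i j)) $ n = xsum (\<lambda>m. \<Sum>i\<le>m. g i (m - i)) $ n" .
qed

lemma xsum_swap: "xsum (\<lambda>i. xsum (\<lambda>j. g i j)) = xsum (\<lambda>j. xsum (\<lambda>i. g i j))"
proof -
  have "(\<Sum>i\<le>m. g i (m - i)) = (\<Sum>i\<le>m. g (m - i) i)" for m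
    by (rule sum.reindex_bij_witness[where i = "\<lambda>i. m - i" and j = "\<lambda>i. m - i"]) auto
  then show ?thesis
    by (simp add: xsum_xsum_antidiagonal)
qed

section \<open>Generating functions of weighted sets\<close>

definition gf :: "('a \<Rightarrow> nat) \<Rightarrow> 'a set \<Rightarrow> int fps" where
  "gf w A = Abs_fps (\<lambda>n. int (card {a \<in> A. w a = n}))"

text \<open>An infinite fibre would have \<open>card\<close> 0 and corrupt its coefficient, so
  additivity and multiplicativity of \<open>gf\<close> need this condition.\<close>

definition finite_fibres :: "('a \<Rightarrow> nat) \<Rightarrow> 'a set \<Rightarrow> bool" where
  "finite_fibres w A \<longleftrightarrow> (\<forall>n. finite {a \<in> A. w a = n})"

lemma gf_nth: "gf w A $ n = int (card {a \<in> A. w a = n})"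
  by (simp add: gf_def)

lemma finite_fibres_subset: "finite_fibres w B \<Longrightarrow> A \<subseteq> B \<Longrightarrow> finite_fibres w A"
proof -
  assume *: "finite_fibres w B" "A \<subseteq> B"
  have "{a \<in> A. w a = n} \<subseteq> {a \<in> B. w a = n}" for n
    using *(2) by auto
  with *(1) show ?thesis
    unfolding finite_fibres_def by (meson finite_subset)
qed

lemma gf_bij_betw:
  assumes "bij_betw f A B" and "\<And>a. a \<in> A \<Longrightarrow> v a = w (f a)"
  shows "gf v A = gf w B"
proof (rule fps_ext)
  fix n
  have "bij_betw f {a \<in> A. v a = n} {b \<in> B. w b = n}"
    using assms unfolding bij_betw_def inj_on_def by auto
  then show "gf v A $ n = gf w B $ n"
    by (simp add: gf_nth bij_betw_same_card)
qed

lemma gf_Un: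
  assumes "finite_fibres w A" and "finite_fibres w B" and "A \<inter> B = {}"
  shows "gf w (A \<union> B) = gf w A + gf w B"
proof (rule fps_ext)
  fix n
  have "{a \<in> A \<union> B. w a = n} = {a \<in> A. w a = n} \<union> {a \<in> B. w a = n}"
    by auto
  then show "gf w (A \<union> B) $ n = (gf w A + gf w B) $ n"
    using assms by (simp add: gf_nth finite_fibres_def) (subst card_Un_disjoint; auto)
qed

lemma gf_shift: "gf (\<lambda>a. c + w a) A = fps_X ^ c * gf w A"
proof (rule fps_ext)
  fix n
  have "{a \<in> A. c + w a = n} = (if n < c then {} else {a \<in> A. w a = n - c})"
    by auto
  then show "gf (\<lambda>a. c + w a) A $ n = (fps_X ^ c * gf w A) $ n"
    by (simp add: gf_nth fps_X_power_mult_nth)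
qed

lemma gf_Times:
  assumes "finite_fibres v A" and "finite_fibres w B"
  shows "gf (\<lambda>(a, b). v a + w b) (A \<times> B) = gf v A * gf w B"
proof (rule fps_ext)
  fix n
  have "{x \<in> A \<times> B. (case x of (a, b) \<Rightarrow> v a + w b) = n}
      = (\<Union>i\<in>{0..n}. {a \<in> A. v a = i} \<times> {b \<in> B. w b = n - i})"
    by auto
  also have "card \<dots> = (\<Sum>i=0..n. card ({a \<in> A. v a = i} \<times> {b \<in> B. w b = n - i}))"
    using assms by (intro card_UN_disjoint) (auto simp: finite_fibres_def)
  finally show "gf (\<lambda>(a, b). v a + w b) (A \<times> B) $ n = (gf v A * gf w B) $ n"
    by (simp add: gf_nth fps_mult_nth card_cartesian_product)
qed

text \<open>The index counts towards the weight, which supplies the shift in \<open>xsum\<close>.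
  Bijections used with this rule must therefore split off one copy of the index from the
  weight.\<close>

lemma gf_Sigma:
  assumes "\<And>i. finite_fibres (w i) (A i)"
  shows "gf (\<lambda>(i, a). i + w i a) (Sigma UNIV A) = xsum (\<lambda>i. gf (w i) (A i))"
proof (rule fps_ext)
  fix n
  have "{x \<in> Sigma UNIV A. (case x of (i, a) \<Rightarrow> i + w i a) = n}
      = (SIGMA i:{..n}. {a \<in> A i. w i a = n - i})"
    by auto
  then show "gf (\<lambda>(i, a). i + w i a) (Sigma UNIV A) $ n = xsum (\<lambda>i. gf (w i) (A i)) $ n"
    using assms by (simp add: gf_nth xsum_nth finite_fibres_def)
qed

lemma finite_fibres_Times:
  assumes "finite_fibres v A" and "finite_fibres w B"
  shows "finite_fibres (\<lambda>(a, b). v a + w b) (A \<times> B)"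
  unfolding finite_fibres_def
proof
  fix n
  have "{x \<in> A \<times> B. (case x of (a, b) \<Rightarrow> v a + w b) = n}
      = (\<Union>i\<in>{0..n}. {a \<in> A. v a = i} \<times> {b \<in> B. w b = n - i})"
    by auto
  then show "finite {x \<in> A \<times> B. (case x of (a, b) \<Rightarrow> v a + w b) = n}"
    using assms by (simp add: finite_fibres_def)
qed

lemma finite_fibres_shift: "finite_fibres w A \<Longrightarrow> finite_fibres (\<lambda>a. c + w a) A"
  unfolding finite_fibres_def
proof
  fix n
  assume *: "\<forall>n. finite {a \<in> A. w a = n}"
  have "{a \<in> A. c + w a = n} \<subseteq> {a \<in> A. w a = n - c}"
    by auto
  with * show "finite {a \<in> A. c + w a = n}"
    by (blast intro: finite_subset)
qed

section \<open>Partitions with restricted parts\<close>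

definition msets :: "nat set \<Rightarrow> nat multiset set" where
  "msets S = {p. set_mset p \<subseteq> S}"

lemma partition_of_iff: "partition_of n p \<longleftrightarrow> p \<in> msets {0<..} \<and> sum_mset p = n"
  by (auto simp: partition_of_def msets_def)

lemma finite_fibres_msets:
  assumes "0 \<notin> S" and "A \<subseteq> msets S"
  shows "finite_fibres sum_mset A"
proof -
  have "finite {p \<in> A. sum_mset p = n}" for n
  proof (rule finite_subset[OF _ finite_partitions[of n]])
    show "{p \<in> A. sum_mset p = n} \<subseteq> {p. partition_of n p}"
    proof
      fix p assume p: "p \<in> {p \<in> A. sum_mset p = n}"
      with assms have "0 \<notin># p" by (auto simp: msets_def)
      then have "\<forall>x\<in>#p. 0 < x" by (metis gr0I)
      with p show "p \<in> {p. partition_of n p}" by (simp add: partition_of_def)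
    qed
  qed
  then show ?thesis
    by (simp add: finite_fibres_def)
qed

definition parts_gf :: "nat set \<Rightarrow> int fps" where
  "parts_gf S = gf sum_mset (msets S)"

lemma parts_gf_empty [simp]: "parts_gf {} = 1"
proof (rule fps_ext)
  fix n
  have "{a \<in> msets {}. sum_mset a = n} = (if n = 0 then {{#}} else {})"
    by (auto simp: msets_def)
  then show "parts_gf {} $ n = 1 $ n"
    by (simp add: parts_gf_def gf_nth)
qed

text \<open>A partition either avoids \<open>i\<close> or arises by adding a copy of
  \<open>i\<close>, so \<open>parts_gf S\<close> is \<open>parts_gf (S - {i})\<close> plus
  \<open>fps_X ^ i * parts_gf S\<close>.\<close>

lemma parts_gf_Diff:
  assumes "i \<in> S" and "0 \<notin> S"
  shows "(1 - fps_X ^ i) * parts_gf S = parts_gf (S - {i})"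
proof -
  have "msets S = msets (S - {i}) \<union> add_mset i ` msets S"
  proof (intro equalityI subsetI)
    fix p assume p: "p \<in> msets S"
    show "p \<in> msets (S - {i}) \<union> add_mset i ` msets S"
    proof (cases "i \<in># p")
      case True
      then have "p = add_mset i (p - {#i#})" "p - {#i#} \<in> msets S"
        using p by (auto simp: msets_def dest: in_diffD)
      then show ?thesis by blast
    next
      case False
      with p show ?thesis by (auto simp: msets_def)
    qed
  qed (use assms in \<open>auto simp: msets_def\<close>)
  then have "parts_gf S = gf sum_mset (msets (S - {i}) \<union> add_mset i ` msets S)"
    by (simp add: parts_gf_def)
  also have "\<dots> = parts_gf (S - {i}) + gf sum_mset (add_mset i ` msets S)"
    unfolding parts_gf_def using assms
    by (intro gf_Un finite_fibres_msets[of S]) (auto simp: msets_def)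
  also have "gf sum_mset (add_mset i ` msets S) = gf (\<lambda>p. i + sum_mset p) (msets S)"
    by (rule sym, rule gf_bij_betw[of "add_mset i"]) (auto simp: bij_betw_def inj_on_def)
  also have "\<dots> = fps_X ^ i * parts_gf S"
    by (simp add: gf_shift parts_gf_def)
  finally show ?thesis
    by (metis add_diff_cancel_right' left_diff_distrib mult_1)
qed

lemma parts_gf_Un:
  assumes "0 \<notin> S \<union> T" and "S \<inter> T = {}"
  shows "parts_gf (S \<union> T) = parts_gf S * parts_gf T"
proof -
  have fin: "finite_fibres sum_mset (msets S)" "finite_fibres sum_mset (msets T)"
    using assms by (auto intro: finite_fibres_msets)
  have "bij_betw (\<lambda>(a, b). a + b) (msets S \<times> msets T) (msets (S \<union> T))"
  proof (rule bij_betwI[where g = "\<lambda>p. (filter_mset (\<lambda>x. x \<in> S) p, filter_mset (\<lambda>x. x \<notin> S) p)"])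
    fix x assume x: "x \<in> msets S \<times> msets T"
    obtain a b where ab: "x = (a, b)" by force
    have "\<And>y. y \<in># a \<Longrightarrow> y \<in> S" "\<And>y. y \<in># b \<Longrightarrow> y \<notin> S"
      using x assms ab by (auto simp: msets_def)
    then have "filter_mset (\<lambda>x. x \<in> S) a = a" "filter_mset (\<lambda>x. x \<in> S) b = {#}"
       "filter_mset (\<lambda>x. x \<notin> S) a = {#}" "filter_mset (\<lambda>x. x \<notin> S) b = b"
      by (simp_all add: filter_mset_eq_conv)
    then show "(filter_mset (\<lambda>x. x \<in> S) (case x of (a, b) \<Rightarrow> a + b),
        filter_mset (\<lambda>x. x \<notin> S) (case x of (a, b) \<Rightarrow> a + b)) = x"
      by (simp add: ab)
  qed (auto simp: msets_def simp flip: multiset_partition)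
  then have "gf (\<lambda>(a, b). sum_mset a + sum_mset b) (msets S \<times> msets T) = parts_gf (S \<union> T)"
    unfolding parts_gf_def by (rule gf_bij_betw) auto
  with gf_Times[OF fin] show ?thesis
    by (simp add: parts_gf_def)
qed

lemma one_minus_X_power_Suc_neq_0: "1 - fps_X ^ Suc i \<noteq> (0 :: int fps)"
proof
  assume "1 - fps_X ^ Suc i = (0 :: int fps)"
  then have "(1 - fps_X ^ Suc i) $ 0 = (0 :: int fps) $ 0" by simp
  then show False by simp
qed

text \<open>In \<open>q\<close>-Pochhammer notation, \<open>q_inv x\<close> is \<open>1/(q;q)\<^sub>x\<close> and \<open>q_tail x\<close> is \<open>1/(q\<^bsup>x+1\<^esup>;q)\<^sub>\<infinity>\<close>.\<close>

abbreviation q_inv :: "nat \<Rightarrow> int fps" where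
  "q_inv x \<equiv> parts_gf {1..x}"

abbreviation q_tail :: "nat \<Rightarrow> int fps" where
  "q_tail x \<equiv> parts_gf {x<..}"

lemma q_inv_Suc: "(1 - fps_X ^ Suc x) * q_inv (Suc x) = q_inv x"
  using parts_gf_Diff[of "Suc x" "{1..Suc x}"] by (simp add: atLeastAtMostSuc_conv del: power_Suc)

lemma q_tail_Suc: "q_tail (Suc x) = (1 - fps_X ^ Suc x) * q_tail x"
proof -
  have "{Suc x<..} = {x<..} - {Suc x}" by auto
  then show ?thesis
    using parts_gf_Diff[of "Suc x" "{x<..}"] by simp
qed

lemma q_inv_tail:
  assumes "x \<le> y"
  shows "parts_gf ({1..x} \<union> {y<..}) = q_inv x * q_tail y"
  using assms by (intro parts_gf_Un) auto

lemma q_inv_times_q_tail: "q_inv x * q_tail x = q_tail 0"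
proof -
  have "{1..x} \<union> {x<..} = {0<..}" by auto
  then show ?thesis using q_inv_tail[of x x] by simp
qed

text \<open>The sum telescopes: by \<open>q_inv_Suc\<close> each new term is
  \<open>q_inv (Suc x) - q_inv x\<close>.\<close>

lemma q_inv_partial_sum: "(\<Sum>i\<le>x. fps_X ^ i * q_inv i) = q_inv x"
proof (induction x)
  case (Suc x)
  then show ?case using q_inv_Suc[of x] by (simp add: algebra_simps)
qed simp

section \<open>Partitions with a prescribed number of parts\<close>

definition large_parts :: "nat \<Rightarrow> nat \<Rightarrow> nat multiset set" where
  "large_parts w r = {p. set_mset p \<subseteq> {w<..} \<and> size p = r}"

text \<open>Zero entries are allowed here, so finiteness comes from the fixed size rather than from
  positivity.\<close>

lemma finite_fibres_size: "finite_fibres sum_mset {p :: nat multiset. size p = r}"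
  unfolding finite_fibres_def
proof
  fix n
  have "{p :: nat multiset. size p = r \<and> sum_mset p = n} \<subseteq> mset ` {xs. set xs \<subseteq> {..n} \<and> length xs = r}"
  proof
    fix p :: "nat multiset" assume p: "p \<in> {p. size p = r \<and> sum_mset p = n}"
    obtain xs where xs: "mset xs = p" using ex_mset by blast
    with p have "sum_list xs = n" "length xs = r" by (auto simp: sum_mset_sum_list)
    then have "set xs \<subseteq> {..n}" "length xs = r"
      using member_le_sum_list by blast+
    with xs show "p \<in> mset ` {xs. set xs \<subseteq> {..n} \<and> length xs = r}" by blast
  qed
  then show "finite {a \<in> {p :: nat multiset. size p = r}. sum_mset a = n}"
    by (simp add: finite_subset finite_lists_length_eq)
qed

lemma sum_mset_image_add:
  fixes p :: "nat multiset"
  shows "sum_mset (image_mset ((+) c) p) = size p * c + sum_mset p"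
  by (induction p) auto

lemma bij_betw_image_mset_add:
  "bij_betw (image_mset ((+) (Suc w))) {p. size p = r} (large_parts w r)"
proof (rule bij_betwI[where g = "image_mset (\<lambda>x. x - Suc w)"])
  fix p assume "p \<in> large_parts w r"
  then show "image_mset ((+) (Suc w)) (image_mset (\<lambda>x. x - Suc w) p) = p"
    by (auto simp: multiset.map_comp large_parts_def o_def intro!: multiset.map_ident_strong)
qed (auto simp: large_parts_def multiset.map_comp o_def)

text \<open>Zeros pad partitions with at most \<open>r\<close> parts to size \<open>r\<close>.
  Instead of conjugating, the proof removes a zero if there is one and otherwise subtracts 1 from
  every entry, which gives the recurrence of \<open>q_inv_Suc\<close>.\<close>

lemma gf_size: "gf sum_mset {p :: nat multiset. size p = r} = q_inv r"
proof (induction r)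
  case 0
  have "{p :: nat multiset. size p = 0} = msets {}" by (auto simp: msets_def)
  then show ?case using parts_gf_empty by (simp add: parts_gf_def)
next
  case (Suc r)
  let ?Z = "\<lambda>r. {p :: nat multiset. size p = r}"
  have "?Z (Suc r) = add_mset 0 ` ?Z r \<union> large_parts 0 (Suc r)"
  proof (intro equalityI subsetI)
    fix p assume p: "p \<in> ?Z (Suc r)"
    show "p \<in> add_mset 0 ` ?Z r \<union> large_parts 0 (Suc r)"
    proof (cases "0 \<in># p")
      case True
      then obtain p' where "p = add_mset 0 p'" by (meson multi_member_split)
      with p show ?thesis by auto
    next
      case False
      then have "set_mset p \<subseteq> {0<..}" by (metis gr0I greaterThan_iff subsetI)
      with p show ?thesis by (simp add: large_parts_def)
    qed
  qed (auto simp: large_parts_def)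
  then have "gf sum_mset (?Z (Suc r)) = gf sum_mset (add_mset 0 ` ?Z r \<union> large_parts 0 (Suc r))"
    by simp
  also have "\<dots> = gf sum_mset (add_mset 0 ` ?Z r) + gf sum_mset (large_parts 0 (Suc r))"
    by (intro gf_Un finite_fibres_subset[OF finite_fibres_size[of "Suc r"]])
      (auto simp: large_parts_def)
  also have "gf sum_mset (add_mset 0 ` ?Z r) = gf sum_mset (?Z r)"
    by (rule sym, rule gf_bij_betw[of "add_mset 0"]) (auto simp: bij_betw_def inj_on_def)
  also have "gf sum_mset (large_parts 0 (Suc r)) = gf (\<lambda>p. Suc r + sum_mset p) (?Z (Suc r))"
    by (rule sym, rule gf_bij_betw[OF bij_betw_image_mset_add])
      (simp add: sum_mset_image_add del: plus_1_eq_Suc)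
  finally have "gf sum_mset (?Z (Suc r))
      = q_inv r + fps_X ^ Suc r * gf sum_mset (?Z (Suc r))"
    unfolding Suc gf_shift .
  then have "(1 - fps_X ^ Suc r) * gf sum_mset (?Z (Suc r)) = q_inv r"
    by (metis add_diff_cancel_right' left_diff_distrib mult_1)
  then show ?case
    using q_inv_Suc[of r] one_minus_X_power_Suc_neq_0[of r] by (metis mult_left_cancel)
qed

lemma gf_large_parts: "gf sum_mset (large_parts w r) = fps_X ^ (r * Suc w) * q_inv r"
proof -
  have "gf (\<lambda>p. r * Suc w + sum_mset p) {p. size p = r} = gf sum_mset (large_parts w r)"
    by (rule gf_bij_betw[OF bij_betw_image_mset_add]) (simp only: sum_mset_image_add mem_Collect_eq)
  then show ?thesis by (simp add: gf_shift gf_size)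
qed

section \<open>Sums of reciprocal Pochhammer symbols\<close>

text \<open>
  The limiting case of the \<open>q\<close>-Vandermonde identity; the \<open>w\<close>-th summand corresponds to a
  Durfee rectangle with sides \<open>w\<close> and \<open>w + r\<close>.
\<close>

lemma q_inv_durfee:
  "(\<Sum>w\<le>N. q_inv (N - w) * q_inv w * fps_X ^ (w * (w + r)) * q_inv (w + r))
     = q_inv N * q_inv (N + r)"
proof (induction N arbitrary: r)
  case 0
  then show ?case by simp
next
  case (Suc N)
  let ?T = "\<lambda>w. fps_X ^ (w * (w + r)) * q_inv (w + r)"
  let ?A = "\<lambda>w. ((1 - fps_X ^ w) * q_inv w) * q_inv (Suc N - w) * ?T w"
  let ?B = "\<lambda>w. fps_X ^ w * ((1 - fps_X ^ (Suc N - w)) * q_inv (Suc N - w)) * q_inv w * ?T w"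
  \<comment> \<open>This splits \<open>1 - a * b\<close> as \<open>(1 - a) + a * (1 - b)\<close>
    with \<open>a = fps_X ^ w\<close> and \<open>b = fps_X ^ (Suc N - w)\<close>. In
    \<open>?A\<close> the first factor lowers \<open>q_inv w\<close>, in \<open>?B\<close> the
    second lowers \<open>q_inv (Suc N - w)\<close>.\<close>
  have summand: "(1 - fps_X ^ Suc N) * (q_inv (Suc N - w) * q_inv w * fps_X ^ (w * (w + r)) * q_inv (w + r))
      = ?A w + ?B w" if "w \<le> Suc N" for w
  proof -
    have *: "(1 - a * b) * (c * d * s * t) = (1 - a) * d * c * (s * t) + a * ((1 - b) * c) * d * (s * t)"
      for a b c d s t :: "int fps"
      by (simp add: algebra_simps)
    have "fps_X ^ Suc N = (fps_X :: int fps) ^ w * fps_X ^ (Suc N - w)"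
      using that by (simp flip: power_add)
    then show ?thesis by (simp only: *)
  qed
  \<comment> \<open>Moving \<open>?A\<close> by one index pairs it with \<open>?B\<close> so that
    the two combine into the summand for \<open>N\<close> and \<open>Suc r\<close>; hence the
    induction over arbitrary \<open>r\<close>.\<close>
  have AB: "?A (Suc w) + ?B w
      = q_inv (N - w) * q_inv w * fps_X ^ (w * (w + Suc r)) * q_inv (w + Suc r)" if "w \<le> N" for w
  proof -
    have A: "?A (Suc w) = q_inv w * q_inv (N - w) * (fps_X ^ (w * (w + Suc r)) * fps_X ^ Suc (w + r) * q_inv (w + Suc r))"
      unfolding q_inv_Suc by (simp add: algebra_simps flip: power_add power_Suc)
    have N: "Suc N - w = Suc (N - w)" using that by simp
    have "?B w = (fps_X ^ w * fps_X ^ (w * (w + r))) * q_inv (N - w) * q_inv w * q_inv (w + r)"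
      unfolding N q_inv_Suc by (simp add: ac_simps)
    also have "(fps_X :: int fps) ^ w * fps_X ^ (w * (w + r)) = fps_X ^ (w * (w + Suc r))"
      by (simp add: algebra_simps flip: power_add)
    also have "fps_X ^ (w * (w + Suc r)) * q_inv (N - w) * q_inv w * q_inv (w + r)
      = fps_X ^ (w * (w + Suc r)) * q_inv (N - w) * q_inv w
        * ((1 - fps_X ^ Suc (w + r)) * q_inv (w + Suc r))"
      using q_inv_Suc[of "w + r"] by simp
    finally have B: "?B w = fps_X ^ (w * (w + Suc r)) * q_inv (N - w) * q_inv w
        * ((1 - fps_X ^ Suc (w + r)) * q_inv (w + Suc r))" .
    have *: "d * c * (s * e * t) + s * c * d * ((1 - e) * t) = c * d * s * t"
      for c d e s t :: "int fps"
      by (simp add: left_diff_distrib right_diff_distrib ac_simps)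
    show ?thesis
      unfolding A B by (rule *)
  qed
  have "(1 - fps_X ^ Suc N)
      * (\<Sum>w\<le>Suc N. q_inv (Suc N - w) * q_inv w * fps_X ^ (w * (w + r)) * q_inv (w + r))
      = (\<Sum>w\<le>Suc N. ?A w + ?B w)"
    unfolding sum_distrib_left by (intro sum.cong refl summand) auto
  also have "\<dots> = (\<Sum>w\<le>Suc N. ?A w) + (\<Sum>w\<le>Suc N. ?B w)"
    by (rule sum.distrib)
  \<comment> \<open>The boundary terms \<open>?A 0\<close> and \<open>?B (Suc N)\<close> vanish
    because they contain the factor \<open>1 - fps_X ^ 0\<close>.\<close>
  also have "(\<Sum>w\<le>Suc N. ?A w) = (\<Sum>w\<le>N. ?A (Suc w))"
    unfolding sum.atMost_Suc_shift[of ?A] by simp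
  also have "(\<Sum>w\<le>Suc N. ?B w) = (\<Sum>w\<le>N. ?B w)"
    unfolding sum.atMost_Suc[of ?B] by simp
  also have "(\<Sum>w\<le>N. ?A (Suc w)) + \<dots> = (\<Sum>w\<le>N. ?A (Suc w) + ?B w)"
    by (rule sum.distrib[symmetric])
  also have "\<dots> = q_inv N * q_inv (N + Suc r)"
    unfolding Suc[of "Suc r", symmetric] by (intro sum.cong refl AB) auto
  also have "\<dots> = (1 - fps_X ^ Suc N) * (q_inv (Suc N) * q_inv (Suc N + r))"
    unfolding q_inv_Suc[of N, symmetric] by (simp add: mult.assoc)
  finally show ?case
    by (rule mult_left_cancel[OF one_minus_X_power_Suc_neq_0, THEN iffD1])
qed

text \<open>
  Up to the exceptional values at 1, the partitions of crank \<open>r \<ge> 0\<close> are generated by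
  \<open>(1 - X) X\<^sup>r cauchy_sum r\<close>.
\<close>

definition cauchy_sum :: "nat \<Rightarrow> int fps" where
  "cauchy_sum r = xsum (\<lambda>w. fps_X ^ (w * (w + r) + w) * q_inv w * q_inv (w + r))"

text \<open>The partitions are grouped by size \<open>c + r\<close>. Raising all entries by
  \<open>Suc w\<close> costs \<open>(c + r) * Suc w\<close>, of which \<open>r\<close> is absorbed
  by the shift in \<open>xsum\<close>.\<close>

lemma gf_large_parts_size_ge:
  "gf sum_mset {p. set_mset p \<subseteq> {w<..} \<and> c \<le> size p}
     = xsum (\<lambda>r. fps_X ^ (c * Suc w + r * w) * q_inv (c + r))"
proof -
  let ?f = "\<lambda>(r :: nat, p). image_mset ((+) (Suc w)) p"
  have "bij_betw ?f (SIGMA r:UNIV. {p. size p = c + r}) {p. set_mset p \<subseteq> {w<..} \<and> c \<le> size p}"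
  proof (rule bij_betwI[where g = "\<lambda>p. (size p - c, image_mset (\<lambda>x. x - Suc w) p)"])
    fix p :: "nat multiset" assume "p \<in> {p. set_mset p \<subseteq> {w<..} \<and> c \<le> size p}"
    then show "?f (size p - c, image_mset (\<lambda>x. x - Suc w) p) = p"
      by (auto simp: multiset.map_comp o_def intro!: multiset.map_ident_strong)
  qed (auto simp: multiset.map_comp o_def)
  then have "gf (\<lambda>(r, p). r + ((c * Suc w + r * w) + sum_mset p)) (SIGMA r:UNIV. {p. size p = c + r})
      = gf sum_mset {p. set_mset p \<subseteq> {w<..} \<and> c \<le> size p}"
    by (rule gf_bij_betw) (auto simp: sum_mset_image_add algebra_simps simp del: add_Suc)
  then show ?thesis
    using gf_Sigma[of "\<lambda>r p. (c * Suc w + r * w) + sum_mset p" "\<lambda>r. {p. size p = c + r}"]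
    by (simp add: finite_fibres_shift finite_fibres_size gf_shift gf_size)
qed

text \<open>Euler's expansion of an infinite product by the number of parts.\<close>

lemma q_tail_eq_xsum: "q_tail w = xsum (\<lambda>r. fps_X ^ (r * w) * q_inv r)"
  using gf_large_parts_size_ge[of w 0] by (simp add: parts_gf_def msets_def)

text \<open>Expanding \<open>q_tail 1\<close> by Euler's formula and grouping by
  \<open>N = y + w\<close> produces the inner sum of \<open>q_inv_durfee\<close>.\<close>

lemma q_tail_1_times_cauchy_sum:
  "q_tail 1 * cauchy_sum r = xsum (\<lambda>N. fps_X ^ N * q_inv N * q_inv (N + r))"
proof -
  have "q_tail 1 * cauchy_sum r = xsum (\<lambda>w. xsum (\<lambda>y. fps_X ^ (y + w) *
      (q_inv y * q_inv w * fps_X ^ (w * (w + r)) * q_inv (w + r))))"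
    unfolding q_tail_eq_xsum cauchy_sum_def mult.commute[of "xsum _" "xsum _"]
    by (subst mult.commute, subst xsum_mult_left) (simp add: xsum_mult_left mult.commute power_add ac_simps)
  also have "\<dots> = xsum (\<lambda>N. \<Sum>w\<le>N. fps_X ^ N *
      (q_inv (N - w) * q_inv w * fps_X ^ (w * (w + r)) * q_inv (w + r)))"
    by (simp add: xsum_xsum_antidiagonal)
  also have "\<dots> = xsum (\<lambda>N. fps_X ^ N * (q_inv N * q_inv (N + r)))"
    by (simp only: sum_distrib_left[symmetric] q_inv_durfee)
  finally show ?thesis by (simp only: mult.assoc)
qed

text \<open>With \<open>y = N + r\<close> fixed, the sum over \<open>N\<close> is evaluated by
  \<open>q_inv_partial_sum\<close>.\<close>

lemma xsum_cauchy_sum: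
  "xsum (\<lambda>r. xsum (\<lambda>N. fps_X ^ N * q_inv N * q_inv (N + r))) = xsum (\<lambda>y. q_inv y * q_inv y)"
proof -
  have "xsum (\<lambda>r. xsum (\<lambda>N. fps_X ^ N * q_inv N * q_inv (N + r)))
      = xsum (\<lambda>N. xsum (\<lambda>r. fps_X ^ N * q_inv N * q_inv (N + r)))"
    by (rule xsum_swap)
  also have "\<dots> = xsum (\<lambda>y. \<Sum>N\<le>y. fps_X ^ N * q_inv N * q_inv y)"
    by (simp add: xsum_xsum_antidiagonal)
  also have "\<dots> = xsum (\<lambda>y. q_inv y * q_inv y)"
    by (simp only: sum_distrib_right[symmetric] q_inv_partial_sum)
  finally show ?thesis .
qed

text \<open>Up to a factor, \<open>s k\<close> is the series of \<open>Ptilde k\<close> (see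
  \<open>Ptilde_gf_eq\<close>); this identity drives the recurrence in \<open>k\<close>.\<close>

lemma xsum_q_tail_recurrence:
  defines "s \<equiv> \<lambda>m. xsum (\<lambda>y. fps_X ^ (m * y) * q_tail (y + m))"
  shows "(1 - fps_X ^ Suc k) * s k + fps_X ^ (2 * Suc k) * (fps_X ^ Suc (Suc k) * s (Suc k))
     = (1 + fps_X ^ Suc k) * q_tail (Suc k)"
proof -
  \<comment> \<open>Keeping the exponent \<open>k * y\<close> and varying only the tail index
    expresses both \<open>s k\<close> and \<open>s (Suc k)\<close> through one family.\<close>
  let ?s = "\<lambda>j. xsum (\<lambda>y. fps_X ^ (k * y) * q_tail (y + j))"
  have split: "?s j = q_tail j + fps_X ^ Suc k * ?s (Suc j)" for j
    by (subst xsum_split) (simp add: xsum_mult_left power_add mult.assoc)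
  have "fps_X ^ Suc (Suc k) * (fps_X ^ (Suc k * y) * q_tail (y + Suc k))
      = fps_X ^ (k * y) * q_tail (y + Suc k) - fps_X ^ (k * y) * q_tail (y + Suc (Suc k))" for y
  proof -
    have "fps_X ^ Suc (Suc k) * fps_X ^ (Suc k * y)
        = (fps_X :: int fps) ^ (k * y) * fps_X ^ Suc (y + Suc k)"
      by (simp add: algebra_simps flip: power_add power_Suc)
    then have "fps_X ^ Suc (Suc k) * (fps_X ^ (Suc k * y) * q_tail (y + Suc k))
        = fps_X ^ (k * y) * (fps_X ^ Suc (y + Suc k) * q_tail (y + Suc k))"
      by (simp only: mult.assoc[symmetric])
    also have "fps_X ^ Suc (y + Suc k) * q_tail (y + Suc k)
        = q_tail (y + Suc k) - q_tail (y + Suc (Suc k))"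
      using q_tail_Suc[of "y + Suc k"] by (simp add: left_diff_distrib)
    finally show ?thesis by (simp add: right_diff_distrib)
  qed
  then have shift: "fps_X ^ Suc (Suc k) * s (Suc k) = ?s (Suc k) - ?s (Suc (Suc k))"
    by (simp only: s_def xsum_mult_left xsum_diff)
  \<comment> \<open>Here \<open>a\<close> is \<open>fps_X ^ Suc k\<close>, \<open>d\<close> and
    \<open>c\<close> are the tails at \<open>k\<close> and \<open>Suc k\<close>, and
    \<open>u\<close>, \<open>u1\<close>, \<open>u2\<close> are consecutive members of
    \<open>?s\<close>.\<close>
  have *: "(1 - a) * u + a\<^sup>2 * (u1 - u2) = (1 + a) * c"
    if "u = d + a * u1" "u1 = c + a * u2" "c = (1 - a) * d" for a c d u u1 u2 :: "int fps"
    unfolding that by (simp add: algebra_simps power2_eq_square)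
  have "fps_X ^ (2 * Suc k) = ((fps_X :: int fps) ^ Suc k)\<^sup>2"
    by (metis mult.commute power_mult)
  then show ?thesis
    unfolding shift using *[OF split[of k] split[of "Suc k"] q_tail_Suc]
    by (simp only: s_def)
qed

section \<open>Partitions by crank\<close>

text \<open>The index \<open>v\<close> is one less than the number of ones. The size of
  \<open>b\<close> is the number of parts exceeding the number of ones, so a crank condition
  \<open>Q\<close> leaves the middle parts \<open>a\<close> free.\<close>

lemma partitions_by_ones_bij_betw:
  "bij_betw (\<lambda>(v, a, b). replicate_mset (Suc v) 1 + a + b)
     (SIGMA v:UNIV. msets {2..Suc v} \<times> {b. set_mset b \<subseteq> {Suc v<..} \<and> Q (Suc v) (size b)})
     {p \<in> msets {0<..}. 1 \<in># p \<and> Q (num_ones p) (num_parts_gt_ones p)}"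
  (is "bij_betw ?f ?A ?B")
proof (rule bij_betwI[where g = "\<lambda>p. (count p 1 - 1,
      filter_mset (\<lambda>x. 1 < x \<and> x \<le> count p 1) p, filter_mset (\<lambda>x. count p 1 < x) p)"])
  have *: "count (?f (v, a, b)) 1 = Suc v \<and> filter_mset (\<lambda>x. 1 < x \<and> x \<le> Suc v) (?f (v, a, b)) = a
      \<and> filter_mset (\<lambda>x. Suc v < x) (?f (v, a, b)) = b"
    if "(v, a, b) \<in> ?A" for v a b
  proof -
    have a: "\<And>x. x \<in># a \<Longrightarrow> 1 < x \<and> x \<le> Suc v" and b: "\<And>x. x \<in># b \<Longrightarrow> Suc v < x"
      using that by (auto simp: msets_def)
    have "count a 1 = 0" "count b 1 = 0"
      using a[of 1] b[of 1] by (auto simp: not_in_iff[symmetric])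
    moreover have "filter_mset (\<lambda>x. 1 < x \<and> x \<le> Suc v) a = a" "filter_mset (\<lambda>x. Suc v < x) a = {#}"
        "filter_mset (\<lambda>x. 1 < x \<and> x \<le> Suc v) b = {#}" "filter_mset (\<lambda>x. Suc v < x) b = b"
      using a b by (force simp: filter_mset_eq_conv)+
    ultimately show ?thesis by simp
  qed
  show "?f \<in> ?A \<rightarrow> ?B"
  proof
    fix t assume t: "t \<in> ?A"
    obtain v a b where vab: "t = (v, a, b)" by (cases t)
    have c: "count (?f (v, a, b)) 1 = Suc v" "filter_mset (\<lambda>x. Suc v < x) (?f (v, a, b)) = b"
      using *[of v a b] t unfolding vab by blast+
    have "num_ones (?f t) = Suc v" "num_parts_gt_ones (?f t) = size b"
      unfolding vab num_parts_gt_ones_def num_ones_def c by (rule refl)+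
    with t show "?f t \<in> ?B" by (auto simp: vab msets_def)
  qed
  show "(\<lambda>p. (count p 1 - 1, filter_mset (\<lambda>x. 1 < x \<and> x \<le> count p 1) p,
      filter_mset (\<lambda>x. count p 1 < x) p)) \<in> ?B \<rightarrow> ?A"
  proof
    fix p assume p: "p \<in> ?B"
    then have "Suc (count p 1 - 1) = count p 1" by (simp add: Suc_le_eq)
    with p show "(count p 1 - 1, filter_mset (\<lambda>x. 1 < x \<and> x \<le> count p 1) p,
      filter_mset (\<lambda>x. count p 1 < x) p) \<in> ?A"
      by (auto simp: msets_def num_parts_gt_ones_def num_ones_def)
  qed
  fix t assume t: "t \<in> ?A"
  obtain v a b where vab: "t = (v, a, b)" by (cases t)
  show "(count (?f t) 1 - 1, filter_mset (\<lambda>x. 1 < x \<and> x \<le> count (?f t) 1) (?f t),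
      filter_mset (\<lambda>x. count (?f t) 1 < x) (?f t)) = t"
    using *[of v a b] t unfolding vab by simp
next
  fix p assume p: "p \<in> ?B"
  show "?f (count p 1 - 1, filter_mset (\<lambda>x. 1 < x \<and> x \<le> count p 1) p,
      filter_mset (\<lambda>x. count p 1 < x) p) = p"
  proof (rule multiset_eqI)
    fix x
    have "0 < count p 1" "count p 0 = 0"
      using p by (auto simp: msets_def not_in_iff[symmetric])
    then show "count (?f (count p 1 - 1, filter_mset (\<lambda>x. 1 < x \<and> x \<le> count p 1) p,
      filter_mset (\<lambda>x. count p 1 < x) p)) x = count p x"
      by (cases "x = 0"; cases "x = 1") auto
  qed
qed

lemma gf_partitions_by_ones:
  "gf sum_mset {p \<in> msets {0<..}. 1 \<in># p \<and> Q (num_ones p) (num_parts_gt_ones p)}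
     = xsum (\<lambda>v. fps_X * ((1 - fps_X) * q_inv (Suc v)
         * gf sum_mset {b. set_mset b \<subseteq> {Suc v<..} \<and> Q (Suc v) (size b)}))"
proof -
  let ?A = "\<lambda>v. msets {2..Suc v}"
  let ?B = "\<lambda>v. {b. set_mset b \<subseteq> {Suc v<..} \<and> Q (Suc v) (size b)}"
  let ?w = "\<lambda>(a, b). sum_mset a + (sum_mset b :: nat)"
  have fin: "finite_fibres sum_mset (?A v)" "finite_fibres sum_mset (?B v)" for v
    by (rule finite_fibres_msets[of "{0<..}"]; auto simp: msets_def)+
  have "gf sum_mset {p \<in> msets {0<..}. 1 \<in># p \<and> Q (num_ones p) (num_parts_gt_ones p)}
      = gf (\<lambda>(v, t). v + (1 + ?w t)) (SIGMA v:UNIV. ?A v \<times> ?B v)"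
    by (rule sym, rule gf_bij_betw[OF partitions_by_ones_bij_betw]) auto
  also have "\<dots> = xsum (\<lambda>v. gf (\<lambda>t. 1 + ?w t) (?A v \<times> ?B v))"
    by (intro gf_Sigma finite_fibres_shift finite_fibres_Times fin)
  also have "\<dots> = xsum (\<lambda>v. fps_X * (parts_gf {2..Suc v} * gf sum_mset (?B v)))"
    unfolding gf_shift gf_Times[OF fin] parts_gf_def by simp
  \<comment> \<open>The factor \<open>1 - fps_X\<close> removes the part 1 from
    \<open>q_inv (Suc v)\<close>, as the ones are already accounted for.\<close>
  also have "\<dots> = xsum (\<lambda>v. fps_X * ((1 - fps_X) * q_inv (Suc v) * gf sum_mset (?B v)))"
  proof -
    have "{2..Suc v} = {1..Suc v} - {1}" for v by auto
    then show ?thesis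
      using parts_gf_Diff[of 1 "{1..Suc v}" for v] by simp
  qed
  finally show ?thesis .
qed

lemma num_ones_eq_0_iff: "num_ones p = 0 \<longleftrightarrow> 1 \<notin># p"
  unfolding num_ones_def by (rule count_eq_zero_iff)

lemma crank_if_one_mem: "1 \<in># p \<Longrightarrow> crank p = int (num_parts_gt_ones p) - int (num_ones p)"
  by (auto simp: crank_def num_ones_eq_0_iff simp del: One_nat_def)

lemma crank_if_one_not_mem: "1 \<notin># p \<Longrightarrow> p \<noteq> {#} \<Longrightarrow> crank p = int (Max (set_mset p))"
  by (simp add: crank_def num_ones_eq_0_iff)

lemma crank_empty: "crank {#} = 0"
  by (simp add: crank_def)

lemma partition_of_1_iff: "partition_of 1 p \<longleftrightarrow> p = {#1#}"
proof
  assume p: "partition_of 1 p"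
  then obtain x q where xq: "p = add_mset x q"
    by (cases p) (auto simp: partition_of_def)
  with p have "0 < x" "x + sum_mset q = 1" "\<forall>y\<in>#q. 0 < y"
    by (simp_all add: partition_of_def)
  then have "x = 1" "partition_of 0 q"
    unfolding partition_of_def by linarith+
  with xq show "p = {#1#}" by (simp add: partition_of_0_iff)
qed (simp add: partition_of_def)

lemma crank_singleton_one: "crank {#1#} = - 1"
  by (simp add: crank_if_one_mem num_ones_def num_parts_gt_ones_def)

lemma Abs_fps_crank_count_zero: "Abs_fps crank_count_zero = (1 - fps_X) * cauchy_sum 0"
proof -
  let ?A = "{p \<in> msets {0<..}. 1 \<in># p \<and> num_parts_gt_ones p = num_ones p}"
  have crank: "{p \<in> msets {0<..}. crank p = 0} = {{#}} \<union> ?A"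
  proof -
    have "crank p = 0 \<longleftrightarrow> p = {#} \<or> 1 \<in># p \<and> num_parts_gt_ones p = num_ones p"
      if "p \<in> msets {0<..}" for p
    proof -
      have "0 < Max (set_mset p)" if "p \<noteq> {#}"
        using that \<open>p \<in> msets {0<..}\<close> by (simp add: msets_def subset_iff)
      then show ?thesis
        by (cases "p = {#}"; cases "1 \<in># p")
          (auto simp: crank_if_one_mem crank_if_one_not_mem crank_empty simp del: One_nat_def)
    qed
    then show ?thesis by (auto simp: msets_def)
  qed
  have fin: "finite_fibres sum_mset {{#}}" "finite_fibres sum_mset ?A"
    by (rule finite_fibres_msets[of "{0<..}"]; auto simp: msets_def)+
  have empty: "gf sum_mset {{#}} = 1"
    using parts_gf_empty by (simp add: parts_gf_def msets_def)
  have gfA: "gf sum_mset ?A = fps_X * xsum (\<lambda>v. (1 - fps_X) *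
      (fps_X ^ (Suc v * Suc v + Suc v) * q_inv (Suc v) * q_inv (Suc v)))"
    unfolding gf_partitions_by_ones[of "\<lambda>w s. s = w"] gf_large_parts[unfolded large_parts_def]
    by (simp add: xsum_mult_left algebra_simps)
  have "gf sum_mset {p \<in> msets {0<..}. crank p = 0} = 1 + gf sum_mset ?A"
    unfolding crank using gf_Un[OF fin] by (simp add: empty)
  \<comment> \<open>The sum in \<open>gfA\<close> covers \<open>w = Suc v\<close>. The missing
    summand \<open>w = 0\<close> contributes \<open>1 - fps_X\<close>: the 1 is the empty partition
    and \<open>- fps_X\<close> the conventional value -1 at 1.\<close>
  also have "\<dots> - fps_X = (1 - fps_X) * cauchy_sum 0"
    unfolding cauchy_sum_def xsum_mult_left gfA by (subst (2) xsum_split) (simp add: xsum_mult_left)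
  finally have main: "gf sum_mset {p \<in> msets {0<..}. crank p = 0} - fps_X
      = (1 - fps_X) * cauchy_sum 0" .
  have "card {p. partition_of 1 p \<and> crank p = 0} = 0"
    unfolding partition_of_1_iff by (auto simp: crank_singleton_one simp del: One_nat_def)
  then have "Abs_fps crank_count_zero = gf sum_mset {p \<in> msets {0<..}. crank p = 0} - fps_X"
    by (intro fps_ext) (auto simp: crank_count_zero_def gf_nth partition_of_iff conj_ac)
  with main show ?thesis by simp
qed

text \<open>Without ones the crank is never negative, and these partitions form the summand
  \<open>w = 0\<close>; partitions with \<open>w > 0\<close> ones and at least \<open>w\<close>
  parts exceeding \<open>w\<close> form the others.\<close>

lemma Abs_fps_crank_count_nonneg:
  "Abs_fps crank_count_nonneg = (1 - fps_X) * xsum cauchy_sum"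
proof -
  let ?A = "{p \<in> msets {0<..}. 1 \<in># p \<and> num_ones p \<le> num_parts_gt_ones p}"
  have crank: "{p \<in> msets {0<..}. 0 \<le> crank p} = msets {1<..} \<union> ?A"
  proof (intro equalityI subsetI)
    fix p assume p: "p \<in> {p \<in> msets {0<..}. 0 \<le> crank p}"
    show "p \<in> msets {1<..} \<union> ?A"
    proof (cases "1 \<in># p")
      case True
      with p show ?thesis by (simp add: crank_if_one_mem)
    next
      case False
      with p show ?thesis by (auto simp: msets_def intro!: Suc_lessI)
    qed
  next
    fix p assume p: "p \<in> msets {1<..} \<union> ?A"
    show "p \<in> {p \<in> msets {0<..}. 0 \<le> crank p}"
    proof (cases "1 \<in># p")
      case True
      with p show ?thesis by (auto simp: msets_def crank_if_one_mem)
    next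
      case False
      with p show ?thesis
        by (cases "p = {#}") (auto simp: msets_def crank_if_one_not_mem crank_empty)
    qed
  qed
  have fin: "finite_fibres sum_mset (msets {1<..})" "finite_fibres sum_mset ?A"
    by (rule finite_fibres_msets[of "{0<..}"]; auto simp: msets_def)+
  let ?T = "\<lambda>w. (1 - fps_X) * xsum (\<lambda>r. fps_X ^ (w * (w + r) + w) * q_inv w * q_inv (w + r))"
  have gfA: "gf sum_mset ?A = fps_X * xsum (\<lambda>v. ?T (Suc v))"
    unfolding gf_partitions_by_ones[of "\<lambda>w s. w \<le> s"]
    by (simp add: xsum_mult_left gf_large_parts_size_ge algebra_simps)
  have "gf sum_mset {p \<in> msets {0<..}. 0 \<le> crank p} = q_tail 1 + gf sum_mset ?A"
    unfolding crank parts_gf_def by (intro gf_Un fin) (auto simp: msets_def)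
  also have "q_tail 1 = (1 - fps_X) * xsum (\<lambda>r. q_inv r)"
    using q_tail_Suc[of 0] q_tail_eq_xsum[of 0] by simp
  also have "\<dots> + gf sum_mset ?A = xsum ?T"
    unfolding gfA by (subst (3) xsum_split) simp
  \<comment> \<open>Swapping the sums regroups by \<open>r\<close>, the excess of the number of
    large parts over the number of ones.\<close>
  also have "\<dots> = (1 - fps_X) * xsum (\<lambda>r. cauchy_sum r)"
    unfolding cauchy_sum_def xsum_mult_left[symmetric] by (subst xsum_swap) simp
  finally have main: "gf sum_mset {p \<in> msets {0<..}. 0 \<le> crank p} = (1 - fps_X) * xsum cauchy_sum" .
  \<comment> \<open>The only partition of 1 has crank -1, so the conventional value 0 is the true
    count and no correction arises.\<close>
  have "card {p. partition_of 1 p \<and> 0 \<le> crank p} = 0"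
    unfolding partition_of_1_iff by (auto simp: crank_singleton_one simp del: One_nat_def)
  then have "Abs_fps crank_count_nonneg = gf sum_mset {p \<in> msets {0<..}. 0 \<le> crank p}"
    by (intro fps_ext) (auto simp: crank_count_nonneg_def gf_nth partition_of_iff conj_ac)
  with main show ?thesis by simp
qed

section \<open>Unimodal compositions\<close>

abbreviation peak_triples :: "(nat \<times> nat multiset \<times> nat multiset) set" where
  "peak_triples \<equiv> (SIGMA v:UNIV. msets {1..Suc v} \<times> msets {1..v})"

text \<open>The peak is the last occurrence of the maximum, so the parts after it are strictly smaller.\<close>

fun peak_list :: "nat \<times> nat multiset \<times> nat multiset \<Rightarrow> nat list" where
  "peak_list (v, a, b) = sorted_list_of_multiset a @ Suc v # rev (sorted_list_of_multiset b)"

lemma Max_peak_list: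
  assumes "(v, a, b) \<in> peak_triples"
  shows "Max (set (peak_list (v, a, b))) = Suc v"
  using assms by (intro Max_eqI) (auto simp: msets_def subset_iff intro: le_SucI)

lemma count_list_peak_list:
  assumes "(v, a, b) \<in> peak_triples"
  shows "count_list (peak_list (v, a, b)) (Suc v) = Suc (count a (Suc v))"
proof -
  have "count_list xs x = count (mset xs) x" for xs and x :: nat
    by (induction xs) auto
  moreover have "count b (Suc v) = 0"
    using assms by (auto simp: msets_def count_eq_zero_iff)
  ultimately show ?thesis by simp
qed

lemma sum_list_peak_list: "sum_list (peak_list (v, a, b)) = v + (1 + (sum_mset a + sum_mset b))"
proof -
  have "sum_list (sorted_list_of_multiset a) = sum_mset a" for a :: "nat multiset"
    by (metis mset_sorted_list_of_multiset sum_mset_sum_list)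
  moreover have "sum_list (rev xs) = sum_list xs" for xs :: "nat list"
    by (metis mset_rev sum_mset_sum_list)
  ultimately show ?thesis by simp
qed

text \<open>Reading the reversed list up to its first \<open>x\<close> recovers
  \<open>ys\<close>.\<close>

lemma split_last_unique:
  assumes "x \<notin> set ys" and "x \<notin> set ys'" and "xs @ x # ys = xs' @ x # ys'"
  shows "xs = xs' \<and> ys = ys'"
proof -
  have "takeWhile (\<lambda>z. z \<noteq> x) (rev (us @ x # vs)) = rev vs" if "x \<notin> set vs" for us vs
    using that by (auto simp: takeWhile_tail intro!: takeWhile_append2[THEN trans])
  with assms have "rev ys = rev ys'" by metis
  with assms(3) show ?thesis by simp
qed

text \<open>The maximum determines \<open>v\<close>, its last occurrence determines the cut, and the
  sorted pieces determine the multisets.\<close>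

lemma inj_on_peak_list: "inj_on peak_list peak_triples"
proof (rule inj_onI)
  fix t t' assume t: "t \<in> peak_triples" "t' \<in> peak_triples" and eq: "peak_list t = peak_list t'"
  obtain v a b v' a' b' where tt: "t = (v, a, b)" "t' = (v', a', b')"
    by (cases t, cases t')
  have v: "v' = v"
    using Max_peak_list[of v a b] Max_peak_list[of v' a' b'] t eq unfolding tt by (simp del: peak_list.simps)
  have "Suc v \<notin> set (rev (sorted_list_of_multiset b))" "Suc v \<notin> set (rev (sorted_list_of_multiset b'))"
    using t by (auto simp: tt v msets_def)
  moreover have "peak_list (v, a, b) = peak_list (v, a', b')"
    using eq by (simp only: tt v)
  ultimately have "sorted_list_of_multiset a = sorted_list_of_multiset a'
      \<and> rev (sorted_list_of_multiset b) = rev (sorted_list_of_multiset b')"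
    unfolding peak_list.simps by (intro split_last_unique)
  then have "sorted_list_of_multiset a = sorted_list_of_multiset a'"
      "sorted_list_of_multiset b = sorted_list_of_multiset b'"
    by simp_all
  then have "a = a'" "b = b'"
    by (metis mset_sorted_list_of_multiset)+
  with v show "t = t'" by (simp add: tt)
qed

lemma unimodal_peak_list:
  assumes "(v, a, b) \<in> peak_triples"
  shows "unimodal (peak_list (v, a, b))"
proof -
  let ?xs = "sorted_list_of_multiset a" and ?ys = "rev (sorted_list_of_multiset b)"
  have le: "\<And>x. x \<in># a \<Longrightarrow> x \<le> Suc v" "\<And>x. x \<in># b \<Longrightarrow> x \<le> Suc v"
    using assms by (auto simp: msets_def)
  have "sorted_wrt (\<le>) (?xs @ [Suc v])" "sorted_wrt (\<ge>) (Suc v # ?ys)"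
    using le by (auto simp: sorted_wrt_append sorted_wrt_rev)
  \<comment> \<open>The witness is the 1-based position of the peak, which belongs to both the
    \<open>take\<close> and the \<open>drop\<close> piece.\<close>
  then show ?thesis
    unfolding unimodal_def by (intro bexI[of _ "Suc (length ?xs)"]) auto
qed

text \<open>The turning index \<open>t\<close> may lie anywhere on the plateau of maximal parts. The
  proof shows that it holds the maximum and does not come after the last occurrence, so moving the
  cut there preserves both orderings.\<close>

lemma unimodal_split:
  assumes "unimodal xs" and "Max (set xs) = M"
  obtains ys zs where "xs = ys @ M # zs" "sorted_wrt (\<le>) ys" "sorted_wrt (\<ge>) zs" "M \<notin> set zs"
proof -
  obtain t where t: "t \<in> {1..length xs}" "sorted_wrt (\<le>) (take t xs)" "sorted_wrt (\<ge>) (drop (t - 1) xs)"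
    using assms(1) unfolding unimodal_def by blast
  have ne: "xs \<noteq> []" using t(1) by auto
  have up: "xs ! i \<le> xs ! j" if "i \<le> j" "j < t" for i j
    using t(1) sorted_wrt_nth_less[OF t(2), of i j] that by (cases "i = j") auto
  have down: "xs ! j \<le> xs ! i" if "t \<le> Suc i" "i \<le> j" "j < length xs" for i j
    using t(1) sorted_wrt_nth_less[OF t(3), of "i - (t - 1)" "j - (t - 1)"] that
    by (cases "i = j") auto
  have le_M: "x \<le> M" if "x \<in> set xs" for x
    using assms(2) that by auto
  have "M \<in> set xs"
    using Max_in[of "set xs"] ne assms(2) by auto
  then obtain ys zs where xs: "xs = ys @ M # zs" "M \<notin> set zs"
    using split_list_last by metis
  have peak: "xs ! (t - 1) = M"
  proof -
    obtain i where i: "i < length xs" "xs ! i = M"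
      using \<open>M \<in> set xs\<close> by (metis in_set_conv_nth)
    have "M \<le> xs ! (t - 1)"
      using i t(1) up[of i "t - 1"] down[of "t - 1" i] by (cases "i \<le> t - 1") auto
    moreover have "xs ! (t - 1) \<in> set xs"
      using t(1) by (intro nth_mem) auto
    ultimately show ?thesis
      using le_M[of "xs ! (t - 1)"] by simp
  qed
  have len: "t - 1 \<le> length ys"
  proof (rule ccontr)
    assume "\<not> t - 1 \<le> length ys"
    then have "xs ! (t - 1) = zs ! (t - 1 - Suc (length ys))" "t - 1 - Suc (length ys) < length zs"
      using t(1) xs(1) by (auto simp: nth_append nth_Cons')
    with peak xs(2) show False by (metis nth_mem)
  qed
  have "sorted_wrt (\<le>) ys"
    unfolding sorted_wrt_iff_nth_less
  proof (intro allI impI)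
    fix i j assume ij: "i < j" "j < length ys"
    then have nth: "ys ! i = xs ! i" "ys ! j = xs ! j"
      using xs(1) by (auto simp: nth_append)
    show "ys ! i \<le> ys ! j"
    proof (cases "j < t")
      case True
      with ij show ?thesis using up[of i j] nth by simp
    next
      case False
      \<comment> \<open>From \<open>t\<close> up to the last occurrence of \<open>M\<close> the list
        is weakly decreasing, so all entries there equal \<open>M\<close>.\<close>
      then have "M \<le> xs ! j"
        using ij down[of j "length ys"] xs(1) by simp
      moreover have "xs ! i \<in> set xs"
        using ij xs(1) by (intro nth_mem) simp
      ultimately show ?thesis
        using nth le_M[of "xs ! i"] by simp
    qed
  qed
  moreover have "sorted_wrt (\<ge>) zs"
    unfolding sorted_wrt_iff_nth_less
  proof (intro allI impI)
    fix i j assume ij: "i < j" "j < length zs"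
    have "zs ! i = xs ! (i + Suc (length ys))" "zs ! j = xs ! (j + Suc (length ys))"
      using xs(1) by (auto simp: nth_append)
    then show "zs ! j \<le> zs ! i"
      using ij len xs(1) down[of "i + Suc (length ys)" "j + Suc (length ys)"] by simp
  qed
  ultimately show ?thesis
    using that xs by blast
qed

lemma peak_list_image:
  "peak_list ` peak_triples = {xs. (\<forall>x\<in>set xs. 0 < x) \<and> unimodal xs}"
proof (intro equalityI subsetI)
  fix xs assume "xs \<in> peak_list ` peak_triples"
  then obtain v a b where "(v, a, b) \<in> peak_triples" "xs = peak_list (v, a, b)"
    by auto
  moreover from this have "\<forall>x\<in>set xs. 0 < x"
    by (auto simp: msets_def subset_iff Suc_le_eq)
  ultimately show "xs \<in> {xs. (\<forall>x\<in>set xs. 0 < x) \<and> unimodal xs}"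
    using unimodal_peak_list by simp
next
  fix xs :: "nat list" assume "xs \<in> {xs. (\<forall>x\<in>set xs. 0 < x) \<and> unimodal xs}"
  then have pos: "\<forall>x\<in>set xs. 0 < x" and uni: "unimodal xs" by auto
  define M where "M = Max (set xs)"
  from uni obtain ys zs
    where xs: "xs = ys @ M # zs" "sorted_wrt (\<le>) ys" "sorted_wrt (\<ge>) zs" "M \<notin> set zs"
    by (rule unimodal_split[OF _ M_def[symmetric]])
  have le_M: "x \<le> M" if "x \<in> set xs" for x
    using that by (simp add: M_def)
  obtain v where v: "M = Suc v"
    using pos xs(1) by (cases M) auto
  have "mset ys \<in> msets {1..Suc v}"
    using pos le_M xs(1) v by (auto simp: msets_def Suc_le_eq)
  moreover have "mset zs \<in> msets {1..v}"
  proof -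
    have "1 \<le> x \<and> x \<le> v" if "x \<in> set zs" for x
      using pos le_M[of x] xs(1,4) v that by (cases "x = M") (auto simp: Suc_le_eq)
    then show ?thesis by (auto simp: msets_def)
  qed
  moreover have "peak_list (v, mset ys, mset zs) = xs"
  proof -
    have "sorted_list_of_multiset (mset ys) = ys"
      using xs(2) by (simp add: sorted_list_of_multiset_mset sorted_sort_id)
    moreover have "sorted_list_of_multiset (mset zs) = rev zs"
      using xs(3) sorted_wrt_rev[of "(\<le>)" "zs"]
      by (metis mset_rev sorted_list_of_multiset_mset sorted_sort_id)
    ultimately show ?thesis by (simp add: xs(1) v)
  qed
  ultimately show "xs \<in> peak_list ` peak_triples"
    by (intro rev_image_eqI[of "(v, mset ys, mset zs)"]) auto
qed

text \<open>The sets \<open>A v\<close> restrict the parts before the peak: unrestricted for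
  \<open>unimodal_count 0\<close>, with a prescribed number of maximal parts otherwise.\<close>

lemma gf_peak_triples:
  assumes "\<And>v. A v \<subseteq> msets {1..Suc v}"
  shows "gf sum_list (peak_list ` (SIGMA v:UNIV. A v \<times> msets {1..v}))
    = xsum (\<lambda>v. fps_X * (gf sum_mset (A v) * q_inv v))"
proof -
  let ?w = "\<lambda>(a, b). sum_mset a + (sum_mset b :: nat)"
  have fin: "finite_fibres sum_mset (A v)" "finite_fibres sum_mset (msets {1..v})" for v
    by (rule finite_fibres_msets[OF _ assms], simp) (rule finite_fibres_msets[OF _ order_refl], simp)
  have "(SIGMA v:UNIV. A v \<times> msets {1..v}) \<subseteq> peak_triples"
    using assms by auto
  then have "bij_betw peak_list (SIGMA v:UNIV. A v \<times> msets {1..v})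
      (peak_list ` (SIGMA v:UNIV. A v \<times> msets {1..v}))"
    by (intro inj_on_imp_bij_betw inj_on_subset[OF inj_on_peak_list])
  then have "gf sum_list (peak_list ` (SIGMA v:UNIV. A v \<times> msets {1..v}))
      = gf (\<lambda>(v, t). v + (1 + ?w t)) (SIGMA v:UNIV. A v \<times> msets {1..v})"
    by (intro sym[OF gf_bij_betw]) (auto simp: sum_list_peak_list simp del: peak_list.simps)
  also have "\<dots> = xsum (\<lambda>v. gf (\<lambda>t. 1 + ?w t) (A v \<times> msets {1..v}))"
    by (intro gf_Sigma finite_fibres_shift finite_fibres_Times fin)
  also have "\<dots> = xsum (\<lambda>v. fps_X * (gf sum_mset (A v) * q_inv v))"
    unfolding gf_shift gf_Times[OF fin] parts_gf_def by simp
  finally show ?thesis .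
qed

lemma unimodal_gf_0:
  "Abs_fps (\<lambda>n. int (unimodal_count 0 (int n))) = xsum (\<lambda>v. fps_X * (q_inv (Suc v) * q_inv v))"
proof -
  have "Abs_fps (\<lambda>n. int (unimodal_count 0 (int n))) = gf sum_list (peak_list ` peak_triples)"
  proof (rule fps_ext)
    fix n
    \<comment> \<open>For \<open>n = 0\<close> nothing is counted: the empty list has no index
      \<open>t\<close>, and a nonempty list with sum 0 contains a zero. This agrees with the
      convention at 0.\<close>
    have "0 \<in> set xs" if "unimodal xs" "sum_list xs = 0" for xs
      using that by (cases xs) (auto simp: unimodal_def)
    then have "{xs \<in> peak_list ` peak_triples. sum_list xs = n}
        = (if n = 0 then {} else {xs. composition_of n xs \<and> unimodal xs})"
      unfolding peak_list_image composition_of_def by (cases "n = 0") (auto simp del: sum_list_eq_0_iff)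
    then show "Abs_fps (\<lambda>n. int (unimodal_count 0 (int n))) $ n
        = gf sum_list (peak_list ` peak_triples) $ n"
      by (simp add: unimodal_count_def gf_nth)
  qed
  also have "\<dots> = xsum (\<lambda>v. fps_X * (q_inv (Suc v) * q_inv v))"
    using gf_peak_triples[of "\<lambda>v. msets {1..Suc v}"] by (simp add: parts_gf_def)
  finally show ?thesis .
qed

lemma gf_msets_count:
  "gf sum_mset {a \<in> msets {1..Suc v}. count a (Suc v) = c} = fps_X ^ (c * Suc v) * q_inv v"
proof -
  have "bij_betw (\<lambda>a. replicate_mset c (Suc v) + a) (msets {1..v})
      {a \<in> msets {1..Suc v}. count a (Suc v) = c}"
  proof (rule bij_betwI[where g = "filter_mset (\<lambda>x. x \<noteq> Suc v)"])
    fix a assume a: "a \<in> msets {1..v}"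
    then have "filter_mset (\<lambda>x. x \<noteq> Suc v) a = a"
      by (auto simp: msets_def filter_mset_eq_conv)
    then show "filter_mset (\<lambda>x. x \<noteq> Suc v) (replicate_mset c (Suc v) + a) = a" by simp
  next
    fix a assume "a \<in> {a \<in> msets {1..Suc v}. count a (Suc v) = c}"
    then show "replicate_mset c (Suc v) + filter_mset (\<lambda>x. x \<noteq> Suc v) a = a"
      by (intro multiset_eqI) auto
  next
    show "(\<lambda>a. replicate_mset c (Suc v) + a) \<in> msets {1..v} \<rightarrow> {a \<in> msets {1..Suc v}. count a (Suc v) = c}"
      by (auto simp: msets_def subset_iff count_eq_zero_iff intro: le_SucI split: if_splits)
    show "filter_mset (\<lambda>x. x \<noteq> Suc v) \<in> {a \<in> msets {1..Suc v}. count a (Suc v) = c} \<rightarrow> msets {1..v}"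
      by (auto simp: msets_def subset_iff le_Suc_eq)
  qed
  then have "gf (\<lambda>a. c * Suc v + sum_mset a) (msets {1..v})
      = gf sum_mset {a \<in> msets {1..Suc v}. count a (Suc v) = c}"
    by (rule gf_bij_betw) simp
  then show ?thesis by (simp add: gf_shift parts_gf_def)
qed

text \<open>The peak is itself one maximal part, so \<open>c\<close> copies of \<open>Suc v\<close>
  precede it.\<close>

lemma unimodal_gf_Suc:
  "Abs_fps (\<lambda>n. int (unimodal_count (Suc c) (int n))) = xsum (\<lambda>v. fps_X ^ (c * v) * (q_inv v * q_inv v))"
proof -
  let ?A = "\<lambda>v. {a \<in> msets {1..Suc v}. count a (Suc v) = c}"
  have set: "peak_list ` (SIGMA v:UNIV. ?A v \<times> msets {1..v})
      = {xs. (\<forall>x\<in>set xs. 0 < x) \<and> unimodal xs \<and> count_list xs (Max (set xs)) = Suc c}"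
  proof -
    have "(SIGMA v:UNIV. ?A v \<times> msets {1..v})
        = {t \<in> peak_triples. count_list (peak_list t) (Max (set (peak_list t))) = Suc c}"
      by (auto simp: Max_peak_list count_list_peak_list simp del: peak_list.simps)
    then have "peak_list ` (SIGMA v:UNIV. ?A v \<times> msets {1..v})
      = {xs \<in> peak_list ` peak_triples. count_list xs (Max (set xs)) = Suc c}"
      by (auto simp del: peak_list.simps)
    then show ?thesis unfolding peak_list_image by auto
  qed
  have "gf sum_list (peak_list ` (SIGMA v:UNIV. ?A v \<times> msets {1..v}))
      = xsum (\<lambda>v. fps_X * (fps_X ^ (c * Suc v) * q_inv v * q_inv v))"
    using gf_peak_triples[of ?A] unfolding gf_msets_count by auto
  also have "\<dots> = fps_X ^ Suc c * xsum (\<lambda>v. fps_X ^ (c * v) * (q_inv v * q_inv v))"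
    unfolding xsum_mult_left by (simp add: power_add ac_simps)
  finally have gf: "gf sum_list (peak_list ` (SIGMA v:UNIV. ?A v \<times> msets {1..v}))
      = fps_X ^ Suc c * xsum (\<lambda>v. fps_X ^ (c * v) * (q_inv v * q_inv v))" .
  show ?thesis
  proof (rule fps_ext)
    fix n
    \<comment> \<open>The offset \<open>n + Suc c\<close> built into \<open>unimodal_count\<close>
      cancels the factor \<open>fps_X ^ Suc c\<close>.\<close>
    have "Abs_fps (\<lambda>n. int (unimodal_count (Suc c) (int n))) $ n
        = gf sum_list (peak_list ` (SIGMA v:UNIV. ?A v \<times> msets {1..v})) $ (n + Suc c)"
      unfolding set by (auto simp: unimodal_count_def gf_nth composition_of_def intro!: arg_cong[where f = card])
    then show "Abs_fps (\<lambda>n. int (unimodal_count (Suc c) (int n))) $ n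
        = xsum (\<lambda>v. fps_X ^ (c * v) * (q_inv v * q_inv v)) $ n"
      unfolding gf by (simp add: fps_X_power_mult_nth del: power_Suc)
  qed
qed

section \<open>Comparison of the crank and unimodal series\<close>

definition crank_gf :: "nat \<Rightarrow> int fps" where
  "crank_gf m = Abs_fps (crank_count m)"

definition unimodal_gf :: "nat \<Rightarrow> int fps" where
  "unimodal_gf m = Abs_fps (\<lambda>n. int (unimodal_count m (int n)))"

lemma q_tail_0_times: "q_tail 0 * ((1 - fps_X) * f) = q_tail 1 * f"
  using q_tail_Suc[of 0] by (simp add: ac_simps)

text \<open>The conventional values at 1 are consistent with this: 1 = 0 - (-1).\<close>

lemma crank_count_pos_eq: "crank_count_pos n = crank_count_nonneg n - crank_count_zero n"
proof -
  have "{p. partition_of n p \<and> 0 \<le> crank p}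
      = {p. partition_of n p \<and> 0 < crank p} \<union> {p. partition_of n p \<and> crank p = 0}"
    by auto
  also have "card \<dots> = card {p. partition_of n p \<and> 0 < crank p} + card {p. partition_of n p \<and> crank p = 0}"
    by (intro card_Un_disjoint finite_subset[OF _ finite_partitions[of n]]) auto
  finally show ?thesis
    by (simp add: crank_count_pos_def crank_count_nonneg_def crank_count_zero_def)
qed

lemma unimodal_gf_1: "unimodal_gf 1 = xsum (\<lambda>v. q_inv v * q_inv v)"
  using unimodal_gf_Suc[of 0] by (simp add: unimodal_gf_def)

lemma unimodal_gf_2: "unimodal_gf 2 = xsum (\<lambda>v. fps_X ^ v * q_inv v * q_inv v)"
  using unimodal_gf_Suc[of 1] by (simp add: unimodal_gf_def numeral_2_eq_2 mult.assoc)

text \<open>The factor \<open>1 - fps_X ^ v\<close> kills the term \<open>v = 0\<close> and lowers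
  one of the two factors \<open>q_inv\<close> in all the others.\<close>

lemma unimodal_gf_0_eq_diff: "unimodal_gf 0 = unimodal_gf 1 - unimodal_gf 2"
proof -
  have "unimodal_gf 1 - unimodal_gf 2 = xsum (\<lambda>v. (1 - fps_X ^ v) * q_inv v * q_inv v)"
    unfolding unimodal_gf_1 unimodal_gf_2 xsum_diff by (simp add: left_diff_distrib)
  also have "\<dots> = fps_X * xsum (\<lambda>v. (1 - fps_X ^ Suc v) * q_inv (Suc v) * q_inv (Suc v))"
    by (subst xsum_split) simp
  also have "\<dots> = unimodal_gf 0"
    unfolding q_inv_Suc unimodal_gf_def unimodal_gf_0 xsum_mult_left by (simp add: ac_simps)
  finally show ?thesis by simp
qed

lemma q_tail_times_crank_gf:
  assumes "m \<in> {0, 1, 2}"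
  shows "q_tail 0 * crank_gf m = unimodal_gf m"
proof -
  have 1: "q_tail 0 * crank_gf 1 = unimodal_gf 1"
  proof -
    have "crank_gf 1 = (1 - fps_X) * xsum (\<lambda>r. cauchy_sum r)"
      using Abs_fps_crank_count_nonneg by (simp add: crank_gf_def crank_count_def)
    then show ?thesis
      unfolding unimodal_gf_1
      by (simp only: q_tail_0_times xsum_mult_left q_tail_1_times_cauchy_sum xsum_cauchy_sum)
  qed
  have 2: "q_tail 0 * crank_gf 2 = unimodal_gf 2"
  proof -
    have "crank_gf 2 = (1 - fps_X) * cauchy_sum 0"
      using Abs_fps_crank_count_zero by (simp add: crank_gf_def crank_count_def)
    then show ?thesis
      unfolding unimodal_gf_2
      by (simp only: q_tail_0_times q_tail_1_times_cauchy_sum add_0_right)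
  qed
  have "crank_gf 0 = crank_gf 1 - crank_gf 2"
    by (rule fps_ext) (simp add: crank_gf_def crank_count_def crank_count_pos_eq)
  then have "q_tail 0 * crank_gf 0 = unimodal_gf 0"
    using 1 2 by (simp add: right_diff_distrib unimodal_gf_0_eq_diff)
  with 1 2 assms show ?thesis by auto
qed

section \<open>The truncated pentagonal number theorem\<close>

definition Ptilde_gf :: "nat \<Rightarrow> int fps" where
  "Ptilde_gf k = Abs_fps (\<lambda>n. int (Ptilde k n))"

text \<open>The first part beyond \<open>k\<close> is \<open>y + Suc k\<close>. Removing one copy of
  each of 1 to \<open>k\<close> and \<open>Suc k\<close> copies of this part leaves an arbitrary
  \<open>r\<close> with parts up to \<open>k\<close> or at least \<open>y + Suc k\<close>.\<close>

lemma Ptilde_bij_betw: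
  "bij_betw (\<lambda>(y, r). mset_set {1..k} + replicate_mset (Suc k) (y + Suc k) + r)
     (SIGMA y:UNIV. msets ({1..k} \<union> {y + k<..}))
     {p \<in> msets {0<..}. (\<forall>i \<in> {1..k}. i \<in># p) \<and>
        (\<exists>x \<in># p. k < x) \<and> k + 1 \<le> count p (Min {x. x \<in># p \<and> k < x})}"
  (is "bij_betw ?f ?A ?B")
proof (rule bij_betwI[where g = "\<lambda>p. let x = Min {x. x \<in># p \<and> k < x}
    in (x - Suc k, p - mset_set {1..k} - replicate_mset (Suc k) x)"])
  let ?g = "\<lambda>p. let x = Min {x. x \<in># p \<and> k < x}
    in (x - Suc k, p - mset_set {1..k} - replicate_mset (Suc k) x)"
  have Min: "Min {x. x \<in># ?f (y, r) \<and> k < x} = y + Suc k" if "(y, r) \<in> ?A" for y r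
  proof (rule Min_eqI)
    show "y + Suc k \<le> x" if "x \<in> {x. x \<in># ?f (y, r) \<and> k < x}" for x
      using that \<open>(y, r) \<in> ?A\<close> by (auto simp: msets_def split: if_splits)
  qed (auto simp: finite_subset[of _ "set_mset (?f (y, r))"])
  show "?f \<in> ?A \<rightarrow> ?B"
  proof
    fix t assume t: "t \<in> ?A"
    obtain y r where yr: "t = (y, r)" by (cases t)
    have "k + 1 \<le> count (?f t) (Min {x. x \<in># ?f t \<and> k < x})"
      using Min[of y r] t unfolding yr by (simp only:) simp
    moreover have "\<forall>i \<in> {1..k}. i \<in># ?f t" "y + Suc k \<in># ?f t" "?f t \<in> msets {0<..}"
      using t by (auto simp: yr msets_def split: if_splits)
    ultimately show "?f t \<in> ?B"
      by (auto intro!: bexI[of _ "y + Suc k"] simp del: split_paired_Ex)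
  qed
  show "?g (?f t) = t" if "t \<in> ?A" for t
    using Min[of "fst t" "snd t"] that by (cases t) (simp only: Let_def fst_conv snd_conv split, simp)
  have p: "mset_set {1..k} + replicate_mset (Suc k) x \<subseteq># p \<and> k < x
      \<and> set_mset p \<subseteq> {1..k} \<union> {x - 1<..}"
    if "p \<in> ?B" and x: "x = Min {x. x \<in># p \<and> k < x}" for p x
  proof -
    have fin: "finite {x. x \<in># p \<and> k < x}"
      by (rule finite_subset[of _ "set_mset p"]) auto
    have "{x. x \<in># p \<and> k < x} \<noteq> {}" using that by auto
    then have "k < x" unfolding x using Min_in[OF fin] by blast
    moreover have "x \<le> z" if "z \<in># p" "k < z" for z
      unfolding x using fin that by (intro Min_le) auto
    moreover have "mset_set {1..k} + replicate_mset (Suc k) x \<subseteq># p"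
    proof (rule mset_subset_eqI)
      fix a
      show "count (mset_set {1..k} + replicate_mset (Suc k) x) a \<le> count p a"
        using that \<open>k < x\<close> by (cases "a \<in> {1..k}"; cases "a = x") (auto simp: Suc_le_eq)
    qed
    moreover have "set_mset p \<subseteq> {0<..}"
      using that(1) by (simp add: msets_def)
    ultimately show ?thesis by (force simp: subset_iff)
  qed
  show "?g \<in> ?B \<rightarrow> ?A"
  proof
    fix p assume "p \<in> ?B"
    then show "?g p \<in> ?A"
      using p[OF _ refl, of p] by (auto simp: Let_def msets_def dest!: in_diffD)
  qed
  show "?f (?g p) = p" if "p \<in> ?B" for p
  proof -
    define x where "x = Min {x. x \<in># p \<and> k < x}"
    note * = p[OF that x_def]
    have "?g p = (x - Suc k, p - (mset_set {1..k} + replicate_mset (Suc k) x))"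
      by (simp add: Let_def x_def)
    then show ?thesis
      using * by (simp del: replicate_mset_Suc)
  qed
qed

lemma Ptilde_gf_eq:
  "Ptilde_gf k = fps_X ^ (\<Sum>{1..k} + (Suc k)\<^sup>2) * q_inv k
     * xsum (\<lambda>y. fps_X ^ (k * y) * q_tail (y + k))"
proof -
  \<comment> \<open>The removed parts weigh \<open>y + ?c y\<close>: \<open>Suc k\<close> copies
    contribute \<open>Suc k * y\<close>, and one \<open>y\<close> goes into the shift of
    \<open>xsum\<close>.\<close>
  let ?c = "\<lambda>y. \<Sum>{1..k} + (Suc k)\<^sup>2 + k * y"
  have "Ptilde_gf k = gf sum_mset {p \<in> msets {0<..}. (\<forall>i \<in> {1..k}. i \<in># p) \<and>
        (\<exists>x \<in># p. k < x) \<and> k + 1 \<le> count p (Min {x. x \<in># p \<and> k < x})}"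
    by (rule fps_ext) (auto simp: Ptilde_gf_def Ptilde_def gf_nth partition_of_iff conj_ac intro!: arg_cong[where f = card])
  also have "\<dots> = gf (\<lambda>(y, r). y + (?c y + sum_mset r)) (SIGMA y:UNIV. msets ({1..k} \<union> {y + k<..}))"
    by (rule sym, rule gf_bij_betw[OF Ptilde_bij_betw])
      (auto simp: sum_unfold_sum_mset power2_eq_square algebra_simps)
  also have "\<dots> = xsum (\<lambda>y. gf (\<lambda>r. ?c y + sum_mset r) (msets ({1..k} \<union> {y + k<..})))"
    by (intro gf_Sigma finite_fibres_shift finite_fibres_msets[OF _ order_refl]) auto
  also have "\<dots> = xsum (\<lambda>y. fps_X ^ ?c y * (q_inv k * q_tail (y + k)))"
    using q_inv_tail[of k "y + k" for y] by (simp add: gf_shift parts_gf_def)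
  also have "\<dots> = fps_X ^ (\<Sum>{1..k} + (Suc k)\<^sup>2) * q_inv k * xsum (\<lambda>y. fps_X ^ (k * y) * q_tail (y + k))"
    unfolding xsum_mult_left by (simp add: power_add ac_simps)
  finally show ?thesis .
qed

text \<open>For \<open>k = 0\<close> the first part beyond \<open>k\<close> is the smallest part and
  need occur only once, so just the empty partition is excluded. This is the base of the induction
  on \<open>k\<close>.\<close>

lemma Ptilde_gf_0: "Ptilde_gf 0 = q_tail 0 - 1"
proof (rule fps_ext)
  fix n
  have "(\<exists>x\<in>#p. 0 < x) \<and> 1 \<le> count p (Min {x. x \<in># p \<and> 0 < x}) \<longleftrightarrow> p \<noteq> {#}"
    if "p \<in> msets {0<..}" for p
  proof -
    have eq: "{x. x \<in># p \<and> 0 < x} = set_mset p" using that by (auto simp: msets_def)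
    show ?thesis
    proof (cases "p = {#}")
      case False
      then have Min: "Min (set_mset p) \<in># p" by simp
      then have "0 < Min (set_mset p)"
        using that unfolding msets_def by blast
      with Min have "\<exists>x\<in>#p. 0 < x" by blast
      moreover have "1 \<le> count p (Min (set_mset p))"
        using Min by (simp only: One_nat_def Suc_le_eq count_greater_zero_iff)
      ultimately show ?thesis
        unfolding eq using False by blast
    qed simp
  qed
  then have set: "{p. partition_of n p \<and> (\<forall>i \<in> {1..0}. i \<in># p) \<and>
              (\<exists>x \<in># p. 0 < x) \<and> 0 + 1 \<le> count p (Min {x. x \<in># p \<and> 0 < x})}
     = {p. partition_of n p} - {{#}}"
    by (auto simp: partition_of_iff)
  have "int (Ptilde 0 n) = int (card {p. partition_of n p}) - (if n = 0 then 1 else 0)"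
  proof (cases "n = 0")
    case True
    then have "{p. partition_of n p} = {{#}}" by (auto simp: partition_of_0_iff)
    with True show ?thesis unfolding Ptilde_def set by simp
  next
    case False
    then have "{p. partition_of n p} - {{#}} = {p. partition_of n p}"
      by (auto simp: partition_of_def)
    with False show ?thesis unfolding Ptilde_def set by simp
  qed
  then show "Ptilde_gf 0 $ n = (q_tail 0 - 1) $ n"
    by (simp add: Ptilde_gf_def parts_gf_def gf_nth partition_of_iff)
qed

text \<open>The hypothesis states without division that \<open>e\<close> is the pentagonal number of
  index \<open>Suc k\<close>; the one of index \<open>- Suc k\<close> is
  \<open>e + Suc k\<close>.\<close>

lemma Ptilde_gf_recurrence:
  assumes "2 * e = Suc k * (3 * k + 2)"
  shows "Ptilde_gf k + Ptilde_gf (Suc k) = q_tail 0 * fps_X ^ e * (1 + fps_X ^ Suc k)"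
proof -
  let ?s = "\<lambda>m. xsum (\<lambda>y. fps_X ^ (m * y) * q_tail (y + m))"
  let ?c = "\<Sum>{1..k} + (Suc k)\<^sup>2"
  have e: "?c = e"
  proof -
    have "2 * \<Sum>{1..k} = k * Suc k"
      by (induction k) auto
    then have "2 * ?c = 2 * e"
      using assms by (simp add: power2_eq_square algebra_simps)
    then show ?thesis by simp
  qed
  have "\<Sum>{1..Suc k} + (Suc (Suc k))\<^sup>2 = ?c + 2 * Suc k + Suc (Suc k)"
    by (simp add: power2_eq_square)
  then have "Ptilde_gf (Suc k) = fps_X ^ ?c * q_inv (Suc k) * (fps_X ^ (2 * Suc k) * (fps_X ^ Suc (Suc k) * ?s (Suc k)))"
    unfolding Ptilde_gf_eq by (simp only: power_add mult.assoc mult.left_commute[of "q_inv (Suc k)"])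
  \<comment> \<open>Writing \<open>q_inv k\<close> as
    \<open>(1 - fps_X ^ Suc k) * q_inv (Suc k)\<close> gives both series a common factor and matches
    \<open>xsum_q_tail_recurrence\<close>.\<close>
  moreover have "Ptilde_gf k = fps_X ^ ?c * q_inv (Suc k) * ((1 - fps_X ^ Suc k) * ?s k)"
    unfolding Ptilde_gf_eq q_inv_Suc[of k, symmetric] by (simp only: mult.assoc mult.left_commute[of "q_inv (Suc k)"])
  ultimately have "Ptilde_gf k + Ptilde_gf (Suc k) = fps_X ^ ?c * q_inv (Suc k)
      * ((1 - fps_X ^ Suc k) * ?s k + fps_X ^ (2 * Suc k) * (fps_X ^ Suc (Suc k) * ?s (Suc k)))"
    by (simp only: distrib_left)
  also have "\<dots> = (q_inv (Suc k) * q_tail (Suc k)) * fps_X ^ ?c * (1 + fps_X ^ Suc k)"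
    unfolding xsum_q_tail_recurrence by (simp only: ac_simps)
  finally show ?thesis
    unfolding q_inv_times_q_tail e .
qed

section \<open>Pentagonal numbers and the induction on \<open>k\<close>\<close>

definition pentagonal :: "int \<Rightarrow> int" where
  "pentagonal j = j * (3 * j - 1) div 2"

definition pentagonal_poly :: "nat \<Rightarrow> int fps" where
  "pentagonal_poly k = (\<Sum>j = - int k..int k. (- 1) ^ nat \<bar>j\<bar> * fps_X ^ nat (pentagonal j))"

lemma two_times_pentagonal: "2 * pentagonal j = j * (3 * j - 1)"
proof -
  have "even (j * (3 * j - 1))" by auto
  then show ?thesis by (simp add: pentagonal_def)
qed

lemma pentagonal_nonneg: "0 \<le> pentagonal j"
proof -
  have "0 \<le> j * (3 * j - 1)"
    by (cases "0 < j") (auto simp: mult_nonneg_nonneg mult_nonpos_nonpos)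
  then show ?thesis by (simp add: pentagonal_def)
qed

lemma pentagonal_poly_Suc:
  assumes "2 * e = Suc k * (3 * k + 2)"
  shows "pentagonal_poly (Suc k)
    = pentagonal_poly k + (- 1) ^ Suc k * (fps_X ^ e * (1 + fps_X ^ Suc k))"
proof -
  let ?f = "\<lambda>j. (- 1) ^ nat \<bar>j\<bar> * (fps_X :: int fps) ^ nat (pentagonal j)"
  have "{- int (Suc k)..int (Suc k)} = insert (int (Suc k)) (insert (- int (Suc k)) {- int k..int k})"
    by auto
  then have "pentagonal_poly (Suc k) = ?f (int (Suc k)) + (?f (- int (Suc k)) + pentagonal_poly k)"
    unfolding pentagonal_poly_def by (simp only:) (subst sum.insert; simp)+
  moreover have "pentagonal (int (Suc k)) = int e"
  proof -
    have "2 * pentagonal (int (Suc k)) = 2 * int e"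
      unfolding two_times_pentagonal using arg_cong[OF assms, of int] by (simp add: algebra_simps)
    then show ?thesis by simp
  qed
  moreover have "pentagonal (- int (Suc k)) = int (e + Suc k)"
  proof -
    have "2 * pentagonal (- int (Suc k)) = 2 * int (e + Suc k)"
      unfolding two_times_pentagonal using arg_cong[OF assms, of int] by (simp add: algebra_simps)
    then show ?thesis by simp
  qed
  moreover have "nat \<bar>int (Suc k)\<bar> = Suc k" "nat \<bar>- int (Suc k)\<bar> = Suc k"
    by simp_all
  ultimately show ?thesis
    by (simp only: nat_int power_add distrib_left mult_1 mult_1_right ac_simps)
qed

lemma truncated_pentagonal: "(- 1) ^ k * (pentagonal_poly k * q_tail 0 - 1) = Ptilde_gf k"
proof (induction k)
  case 0
  then show ?case by (simp add: pentagonal_poly_def pentagonal_def Ptilde_gf_0)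
next
  case (Suc k)
  have "even (Suc k * (3 * k + 2))" by simp
  then obtain e where e: "2 * e = Suc k * (3 * k + 2)" by (metis evenE)
  have sign: "(- 1) ^ k * (- 1) ^ k = (1 :: int fps)"
    by (simp flip: power_mult_distrib)
  \<comment> \<open>Here \<open>s\<close> is the sign \<open>(- 1) ^ k\<close>, \<open>p\<close> the
    truncated sum, \<open>a\<close> the new pair of terms without sign, \<open>q\<close> is
    \<open>q_tail 0\<close> and \<open>g\<close> is \<open>Ptilde_gf k\<close>.\<close>
  have *: "- s * ((p + - s * a) * q - 1) = q * a - g"
    if "s * s = 1" "s * (p * q - 1) = g" for s p a q g :: "int fps"
  proof -
    have "- s * ((p + - s * a) * q - 1) = (s * s) * a * q - s * (p * q - 1)"
      by (simp add: algebra_simps)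
    then show ?thesis using that by (simp add: ac_simps)
  qed
  have rec: "Ptilde_gf (Suc k) = q_tail 0 * (fps_X ^ e * (1 + fps_X ^ Suc k)) - Ptilde_gf k"
    using Ptilde_gf_recurrence[OF e] by (simp only: mult.assoc eq_diff_eq add.commute)
  show ?case
    unfolding pentagonal_poly_Suc[OF e] rec power_Suc mult_minus1 by (rule *[OF sign Suc])
qed

theorem theorem1p4:
  fixes k n m :: nat
  assumes "1 \<le> k" and "1 \<le> n" and "m \<in> {0, 1, 2}"
  shows "(-1) ^ (k - 1) *
           (crank_count m n
            - (\<Sum>j = - int k..int k.
                 (-1) ^ nat \<bar>j\<bar> * int (unimodal_count m (int n - (j * (3 * j - 1)) div 2))))
         = (\<Sum>j = 0..n. crank_count m j * int (Ptilde k (n - j)))"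
proof -
  \<comment> \<open>If the pentagonal number exceeds \<open>n\<close>, both sides are 0, on the left
    by the convention for negative arguments.\<close>
  have shift: "int (unimodal_count m (int n - (j * (3 * j - 1)) div 2))
      = (fps_X ^ nat (pentagonal j) * unimodal_gf m) $ n" for j
    using pentagonal_nonneg[of j]
    by (auto simp: pentagonal_def[symmetric] fps_X_power_mult_nth unimodal_gf_def unimodal_count_def
        nat_less_iff of_nat_diff)
  \<comment> \<open>Signs become constant series so that they pass through coefficient
    extraction.\<close>
  have neg: "(- 1) ^ i * f = fps_const ((- 1) ^ i) * f" for i and f :: "int fps"
    by (simp flip: fps_const_power fps_const_neg)
  have sum: "(\<Sum>j = - int k..int k.
        (-1) ^ nat \<bar>j\<bar> * int (unimodal_count m (int n - (j * (3 * j - 1)) div 2)))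
      = (pentagonal_poly k * unimodal_gf m) $ n"
    unfolding pentagonal_poly_def shift sum_distrib_right fps_sum_nth mult.assoc neg by simp
  obtain i where k: "k = Suc i" using assms(1) by (cases k) auto
  have "crank_gf m * Ptilde_gf k = (- 1) ^ k * (pentagonal_poly k * (q_tail 0 * crank_gf m) - crank_gf m)"
    unfolding truncated_pentagonal[of k, symmetric] by (simp add: algebra_simps)
  \<comment> \<open>Since \<open>k\<close> is positive, exchanging the two terms of the difference
    turns \<open>(- 1) ^ k\<close> into \<open>(- 1) ^ (k - 1)\<close>.\<close>
  also have "\<dots> = (- 1) ^ (k - 1) * (crank_gf m - pentagonal_poly k * unimodal_gf m)"
    unfolding q_tail_times_crank_gf[OF assms(3)] k by (simp add: algebra_simps)
  finally have "(crank_gf m * Ptilde_gf k) $ n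
      = (- 1) ^ (k - 1) * (crank_count m n - (pentagonal_poly k * unimodal_gf m) $ n)"
    unfolding neg by (simp add: crank_gf_def)
  then show ?thesis
    unfolding sum by (simp add: fps_mult_nth crank_gf_def Ptilde_gf_def)
qed

end
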